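(* Let $G$ be an infinite, connected and locally finite graph with exhaustion $(G_n)_{n\in\mathbb{N}}$. Let $\mathcal{R}_n$ be the sandpile group of $G_n$ and $\mu_n$ the uniform measure on $\mathcal{R}_n$, for every $n\in\mathbb{N}$, and assume that the infinite volume limit $\mu$ exists as the weak limit of the sequence $(\mu_n)_{n\in\mathbb{N}}$. If there exists $M\in\mathbb{N}$ such that for all $n\in\mathbb{N}$ and all $\eta_n\in\mathcal{R}_n$ the order of $[\eta_n]$ in the sandpile group of $G_n$ satisfies $\mathrm{ord}([\eta_n])<M$, then there is a constant $c>0$ such that for every vertex $x$ of $G$ and every $R>0$, $$\mu\big(\mathrm{diam}(\mathsf{T}(\eta+\delta_x))>R\big)>c,$$ where $\eta$ is sampled from $\mu$.
   Context: **Exhaustion.** $V_1\subset V_2\subset\cdots$ is an increasing sequence of finite vertex sets of $G=(V,E)$ with $\bigcup_n V_n=V$, and $G_n$ is the finite graph with vertex set $V_n\cup\{s_n\}$ obtained from $G$ by identifying all vertices outside $V_n$ with a single sink vertex $s_n$ (keeping multiple edges to $s_n$, deleting loops). Thus each $v\in V_n$ has the same degree in $G_n$ as in $G$. **Sandpiles on $G_n$.** A sandpile on $G_n$ is $\sigma:V_n\to\mathbb{N}$, $\mathbb{N}=\{0,1,2,\dots\}$; it is stable if $\sigma(v)<\deg(v)$ for all $v\in V_n$. Toppling $v\in V_n$ replaces $\sigma$ by $\sigma-\Delta_n\delta_v$, where $\Delta_n$ is the graph Laplacian of $G_n$ restricted to $V_n\times V_n$ (diagonal entries $\deg(x)$,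 entry $-1$ for neighbours $x\sim y$, $0$ otherwise); particles sent to the sink are lost. It is legal if $\sigma(v)\ge\deg(v)$. Every sandpile $\sigma$ is transformed by finitely many legal topplings into a unique stable sandpile $\sigma^\circ$. The sandpile Markov chain on stable sandpiles is $\sigma_{k+1}=(\sigma_k+\delta_{Y_{k+1}})^\circ$ with $Y_1,Y_2,\dots$ i.i.d. uniform on $V_n$; its set $\mathcal{R}_n$ of recurrent states is an Abelian group under $\eta\oplus\zeta=(\eta+\zeta)^\circ$ (the sandpile group), and $\eta\mapsto[\eta]$ is an isomorphism $\mathcal{R}_n\cong\mathbb{Z}^{V_n}/\Delta_n\mathbb{Z}^{V_n}$, where $[\eta]$ is the class of $\eta$. $\mathrm{ord}([\eta])$ is the order of the group element $[\eta]$. **Infinite volume limit.** $\mu$ is the probability measure on $\mathbb{N}^V$ with $\mu(\eta|_A=\xi)=\lim_{n\to\infty}\mu_n(\eta|_A=\xi)$ for every finite $A\subset V$ and $\xi\in\mathbb{N}^A$. **Toppled set and diameter.** For a configuration $\sigma:V\to\mathbb{N}$ on $G$, $\mathsf{T}(\sigma)$ is the (possibly infinite) set of all vertices that topple during the stabilization of $\sigma$ on $G$, i.e. the set of vertices that topple in some finite sequence of legal topplings (a toppling at $v$ is legal if the current height at $v$ is at least $\deg(v)$) started from $\sigma$. $\delta_x$ is the function with value $1$ at $x$ and $0$ elsewhere. For $A\subseteq G$, $\mathrm{diam}(A)=\sup\{d(v,w):v,w\in A\}$ with $d$ the graph distance in $G$ (and $\mathrm{diam}(\emptyset)=0$). 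*)

theory Defs
  imports
    "HOL-Probability.Probability"
    "HOL-Algebra.Product_Groups"
    "HOL-Algebra.Multiplicative_Group"
begin

(* The vertex set of G is the whole type 'v; G is a simple graph given by its adjacency
   relation. *)

definition infinite_connected_locally_finite_graph :: "('v \<Rightarrow> 'v \<Rightarrow> bool) \<Rightarrow> bool" where
  "infinite_connected_locally_finite_graph adj \<longleftrightarrow>
     symp adj \<and> irreflp adj \<and> infinite (UNIV :: 'v set) \<and>
     (\<forall>x y. adj\<^sup>*\<^sup>* x y) \<and> (\<forall>x. finite {y. adj x y})"

definition graph_dist :: "('v \<Rightarrow> 'v \<Rightarrow> bool) \<Rightarrow> 'v \<Rightarrow> 'v \<Rightarrow> enat" where
  "graph_dist adj v w = Inf {enat k | k. (adj ^^ k) v w}"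

(* The supremum is taken in enat, so that the diameter of the empty set is 0. *)
definition graph_diam :: "('v \<Rightarrow> 'v \<Rightarrow> bool) \<Rightarrow> 'v set \<Rightarrow> enat" where
  "graph_diam adj A = (SUP v\<in>A. SUP w\<in>A. graph_dist adj v w)"

definition exhaustion :: "(nat \<Rightarrow> 'v set) \<Rightarrow> bool" where
  "exhaustion V \<longleftrightarrow> incseq V \<and> (\<forall>n. finite (V n)) \<and> (\<Union>n. V n) = UNIV"

definition unit_mass :: "'v \<Rightarrow> 'v \<Rightarrow> nat" where
  "unit_mass x = (\<lambda>v. if v = x then 1 else 0)"


(* The graph obtained from G by identifying all vertices outside W: its vertices are
   Some v (v in W) together with the sink None. An unordered pair of distinct vertices a, b is
   joined by sink_graph_mult adj W a b edges, one for every edge of G mapped onto it;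
   loops are deleted. *)

definition collapse :: "'v set \<Rightarrow> 'v \<Rightarrow> 'v option" where
  "collapse W v = (if v \<in> W then Some v else None)"

definition sink_graph_mult ::
    "('v \<Rightarrow> 'v \<Rightarrow> bool) \<Rightarrow> 'v set \<Rightarrow> 'v option \<Rightarrow> 'v option \<Rightarrow> nat" where
  "sink_graph_mult adj W a b =
     (if a = b then 0
      else card {(x, y). adj x y \<and> collapse W x = a \<and> collapse W y = b})"

definition sink_graph_deg :: "('v \<Rightarrow> 'v \<Rightarrow> bool) \<Rightarrow> 'v set \<Rightarrow> 'v \<Rightarrow> nat" where
  "sink_graph_deg adj W v = (\<Sum>b\<in>insert None (Some ` W). sink_graph_mult adj W (Some v) b)"

definition lap_entry :: "('v \<Rightarrow> 'v \<Rightarrow> bool) \<Rightarrow> 'v set \<Rightarrow> 'v \<Rightarrow> 'v \<Rightarrow> int" where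
  "lap_entry adj W x y =
     (if x = y then int (sink_graph_deg adj W x)
      else - int (sink_graph_mult adj W (Some x) (Some y)))"

definition lap :: "('v \<Rightarrow> 'v \<Rightarrow> bool) \<Rightarrow> 'v set \<Rightarrow> ('v \<Rightarrow> int) \<Rightarrow> 'v \<Rightarrow> int" where
  "lap adj W f = (\<lambda>x\<in>W. \<Sum>y\<in>W. lap_entry adj W x y * f y)"


(* Functions on W are extensional, i.e. undefined outside W, as in product_group. *)

definition sandpiles :: "'v set \<Rightarrow> ('v \<Rightarrow> nat) set" where
  "sandpiles W = (W \<rightarrow>\<^sub>E UNIV)"

definition stable_sandpiles :: "('v \<Rightarrow> 'v \<Rightarrow> bool) \<Rightarrow> 'v set \<Rightarrow> ('v \<Rightarrow> nat) set" where
  "stable_sandpiles adj W = {\<sigma> \<in> sandpiles W. \<forall>v\<in>W. \<sigma> v < sink_graph_deg adj W v}"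

definition legal_topple ::
    "('v \<Rightarrow> 'v \<Rightarrow> bool) \<Rightarrow> 'v set \<Rightarrow> ('v \<Rightarrow> nat) \<Rightarrow> ('v \<Rightarrow> nat) \<Rightarrow> bool" where
  "legal_topple adj W \<sigma> \<tau> \<longleftrightarrow> \<sigma> \<in> sandpiles W \<and> \<tau> \<in> sandpiles W \<and>
     (\<exists>v\<in>W. sink_graph_deg adj W v \<le> \<sigma> v \<and>
        (\<forall>u\<in>W. int (\<tau> u) = int (\<sigma> u) - lap adj W (\<lambda>y. int (unit_mass v y)) u))"

definition stabilization ::
    "('v \<Rightarrow> 'v \<Rightarrow> bool) \<Rightarrow> 'v set \<Rightarrow> ('v \<Rightarrow> nat) \<Rightarrow> ('v \<Rightarrow> nat)" where
  "stabilization adj W \<sigma> =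
     (THE \<tau>. \<tau> \<in> stable_sandpiles adj W \<and> (legal_topple adj W)\<^sup>*\<^sup>* \<sigma> \<tau>)"

(* The trajectory of the sandpile Markov chain started at \<sigma>, as a function of the driving
   sequence Y of vertices. *)
primrec sandpile_chain ::
    "('v \<Rightarrow> 'v \<Rightarrow> bool) \<Rightarrow> 'v set \<Rightarrow> ('v \<Rightarrow> nat) \<Rightarrow> (nat \<Rightarrow> 'v) \<Rightarrow> nat \<Rightarrow> ('v \<Rightarrow> nat)" where
  "sandpile_chain adj W \<sigma> Y 0 = \<sigma>"
| "sandpile_chain adj W \<sigma> Y (Suc k) =
     stabilization adj W (\<lambda>v\<in>W. sandpile_chain adj W \<sigma> Y k v + unit_mass (Y k) v)"

(* Recurrence in the sense of Markov chains: with probability 1 the chain started at \<sigma>, driven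
   by i.i.d. uniform vertices of W, returns to \<sigma>. *)
definition recurrent_sandpiles :: "('v \<Rightarrow> 'v \<Rightarrow> bool) \<Rightarrow> 'v set \<Rightarrow> ('v \<Rightarrow> nat) set" where
  "recurrent_sandpiles adj W =
     {\<sigma> \<in> stable_sandpiles adj W.
        AE Y in Pi\<^sub>M (UNIV :: nat set) (\<lambda>_. measure_pmf (pmf_of_set W)).
          \<exists>k>0. sandpile_chain adj W \<sigma> Y k = \<sigma>}"


abbreviation int_functions :: "'v set \<Rightarrow> ('v \<Rightarrow> int) monoid" where
  "int_functions W \<equiv> product_group W (\<lambda>_. integer_group)"

definition lap_image :: "('v \<Rightarrow> 'v \<Rightarrow> bool) \<Rightarrow> 'v set \<Rightarrow> ('v \<Rightarrow> int) set" where
  "lap_image adj W = lap adj W ` carrier (int_functions W)"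

definition sandpile_group :: "('v \<Rightarrow> 'v \<Rightarrow> bool) \<Rightarrow> 'v set \<Rightarrow> ('v \<Rightarrow> int) set monoid" where
  "sandpile_group adj W = int_functions W Mod lap_image adj W"

definition sandpile_class ::
    "('v \<Rightarrow> 'v \<Rightarrow> bool) \<Rightarrow> 'v set \<Rightarrow> ('v \<Rightarrow> nat) \<Rightarrow> ('v \<Rightarrow> int) set" where
  "sandpile_class adj W \<eta> = lap_image adj W #>\<^bsub>int_functions W\<^esub> (\<lambda>v\<in>W. int (\<eta> v))"


(* For given A the condition only matters for those n with A contained in V n. *)
definition infinite_volume_limit ::
    "('v \<Rightarrow> 'v \<Rightarrow> bool) \<Rightarrow> (nat \<Rightarrow> 'v set) \<Rightarrow> ('v \<Rightarrow> nat) measure \<Rightarrow> bool" where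
  "infinite_volume_limit adj V \<mu> \<longleftrightarrow>
     prob_space \<mu> \<and> sets \<mu> = sets (Pi\<^sub>M UNIV (\<lambda>_. count_space UNIV)) \<and>
     (\<forall>A \<xi>. finite A \<longrightarrow>
        (\<lambda>n. measure_pmf.prob (pmf_of_set (recurrent_sandpiles adj (V n))) {\<eta>. \<forall>v\<in>A. \<eta> v = \<xi> v})
          \<longlonglongrightarrow> measure \<mu> {\<eta>. \<forall>v\<in>A. \<eta> v = \<xi> v})"


definition topple :: "('v \<Rightarrow> 'v \<Rightarrow> bool) \<Rightarrow> 'v \<Rightarrow> ('v \<Rightarrow> nat) \<Rightarrow> ('v \<Rightarrow> nat)" where
  "topple adj v \<sigma> =
     (\<lambda>u. if u = v then \<sigma> v - card {y. adj v y} else if adj v u then \<sigma> u + 1 else \<sigma> u)"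

fun legal_sequence :: "('v \<Rightarrow> 'v \<Rightarrow> bool) \<Rightarrow> ('v \<Rightarrow> nat) \<Rightarrow> 'v list \<Rightarrow> bool" where
  "legal_sequence adj \<sigma> [] = True"
| "legal_sequence adj \<sigma> (v # vs) \<longleftrightarrow>
     card {y. adj v y} \<le> \<sigma> v \<and> legal_sequence adj (topple adj v \<sigma>) vs"

definition toppled_set :: "('v \<Rightarrow> 'v \<Rightarrow> bool) \<Rightarrow> ('v \<Rightarrow> nat) \<Rightarrow> 'v set" where
  "toppled_set adj \<sigma> = {v. \<exists>vs. legal_sequence adj \<sigma> vs \<and> v \<in> set vs}"

end

theory Submission
  imports Defs "HOL-Library.Confluence"
begin

text \<open>
  Why it is true. Let \<open>W\<close> be a finite domain of the exhaustion, \<open>\<R>\<close> its set of recurrent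
  sandpiles and \<open>L = M!\<close>. Every order in the sandpile group is at least 1 and less than \<open>M\<close>, hence
  divides \<open>L\<close>, so the class of \<open>L \<delta>\<^sub>x\<close> is trivial. Adding a grain at \<open>x\<close> and stabilizing permutes
  \<open>\<R>\<close>, and the \<open>L\<close>-th power of this permutation is therefore the identity: after \<open>L\<close> additions at
  \<open>x\<close> every \<open>\<eta> \<in> \<R>\<close> has come back to itself. Let \<open>u v\<close> be the number of topplings at \<open>v\<close> during
  these \<open>L\<close> additions. The balance of grains says \<open>\<Delta> u = L \<delta>\<^sub>x\<close>, and a natural-number valued
  solution of this equation is positive at \<open>x\<close> and, by the minimum principle, at every \<open>y\<close> that is
  connected to \<open>x\<close> inside \<open>W\<close> (\<open>lap_multiple_of_unit_mass_pos\<close>). So \<open>y\<close> topples in at least one of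
  the \<open>L\<close> additions. As the uniform measure on \<open>\<R>\<close> is invariant under each addition, a union bound
  gives that \<open>y\<close> topples in the first one with probability at least \<open>1 / L\<close>, uniformly in \<open>W\<close>,
  \<open>x\<close> and \<open>y\<close> (\<open>prob_topples_within\<close>).

  To pass to the infinite volume, fix \<open>r\<close>, let \<open>K\<close> be the ball of radius \<open>r\<close> around \<open>x\<close> and choose
  \<open>y\<close> outside of it. If \<open>y\<close> topples, then the toppling sequence cut at its first vertex outside
  \<open>K\<close> shows that the avalanche leaves \<open>K\<close> through a neighbour of \<open>K\<close>
  (\<open>escapes_if_topples_outside\<close>). This event depends only on the finitely many stable heights on the
  closed neighbourhood of \<open>K\<close>, so its probability passes to the limit \<open>\<mu>\<close>. On it both \<open>x\<close> and a
  vertex at distance more than \<open>r\<close> from \<open>x\<close> topple, so the diameter exceeds \<open>r\<close>.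

  Two classical facts about finite domains are developed for this. Stabilization is well defined,
  because toppling is confluent and decreases a weight built from the distance to the complement.
  Recurrence, given as almost sure return of the Markov chain, is equivalent to being fixed by some
  addition that is positive everywhere (\<open>recurrent_iff\<close>); from this it follows that additions permute
  the recurrent sandpiles, and that equivalent additions act on them in the same way.
\<close>

section \<open>Toppling sequences\<close>

lemma topple_agree:
  assumes "\<forall>u\<in>A. \<sigma> u = \<sigma>' u"
  shows "\<forall>u\<in>A. topple adj v \<sigma> u = topple adj v \<sigma>' u"
  using assms by (auto simp: topple_def)

lemma legal_sequence_agree:
  assumes "set vs \<subseteq> A" "\<forall>u\<in>A. \<sigma> u = \<sigma>' u"
  shows "legal_sequence adj \<sigma> vs = legal_sequence adj \<sigma>' vs"
  using assms
proof (induction vs arbitrary: \<sigma> \<sigma>')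
  case (Cons v vs)
  then show ?case
    using Cons.IH[OF _ topple_agree[OF Cons.prems(2), of adj v]] by auto
qed simp

lemma legal_sequence_append:
  "legal_sequence adj \<sigma> (us @ vs) \<longleftrightarrow>
     legal_sequence adj \<sigma> us \<and> legal_sequence adj (fold (topple adj) us \<sigma>) vs"
  by (induction us arbitrary: \<sigma>) auto

locale locally_finite_graph =
  fixes adj :: "'v \<Rightarrow> 'v \<Rightarrow> bool"
  assumes adj_sym: "adj x y \<Longrightarrow> adj y x"
    and adj_irrefl: "\<not> adj x x"
    and finite_nbrs: "finite {y. adj x y}"
begin

abbreviation deg :: "'v \<Rightarrow> nat" where "deg v \<equiv> card {y. adj v y}"

lemma adj_commute: "adj x y \<longleftrightarrow> adj y x"
  using adj_sym by blast

lemma topple_commute: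
  assumes "v \<noteq> w" "deg v \<le> \<sigma> v" "deg w \<le> \<sigma> w"
  shows "topple adj v (topple adj w \<sigma>) = topple adj w (topple adj v \<sigma>)"
  using assms adj_sym by (auto simp: topple_def fun_eq_iff)

text \<open>Balance of grains: the heights after a legal sequence depend only on how often each vertex
  toppled. The truncated subtraction in the definition of toppling is exact because the topplings
  are legal.\<close>

lemma fold_topple_eq:
  assumes "legal_sequence adj \<sigma> vs"
  shows "int (fold (topple adj) vs \<sigma> u) =
    int (\<sigma> u) - int (deg u) * int (count_list vs u) + (\<Sum>v | adj u v. int (count_list vs v))"
  using assms
proof (induction vs arbitrary: \<sigma>)
  case (Cons v vs)
  have "(\<Sum>w | adj u w. int (count_list (v # vs) w)) =
      (\<Sum>w | adj u w. int (count_list vs w)) + (\<Sum>w | adj u w. if v = w then 1 else 0)"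
    by (subst sum.distrib[symmetric], rule sum.cong) auto
  also have "(\<Sum>w | adj u w. if v = w then 1 else 0) = (if adj u v then 1 else (0::int))"
    using finite_nbrs[of u] by (simp add: sum.delta)
  finally have s: "(\<Sum>w | adj u w. int (count_list (v # vs) w)) =
      (\<Sum>w | adj u w. int (count_list vs w)) + (if adj u v then 1 else 0)" .
  have "int (topple adj v \<sigma> u) =
      int (\<sigma> u) - (if u = v then int (deg u) else 0) + (if adj u v then 1 else 0)"
    using Cons.prems adj_irrefl[of u] adj_commute[of u v] by (auto simp: topple_def)
  moreover have "int (fold (topple adj) (v # vs) \<sigma> u) = int (topple adj v \<sigma> u)
      - int (deg u) * int (count_list vs u) + (\<Sum>v | adj u v. int (count_list vs v))"
    using Cons.IH[of "topple adj v \<sigma>"] Cons.prems by simp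
  ultimately show ?case unfolding s by (auto simp: algebra_simps)
qed simp

lemma sink_graph_mult_Some:
  assumes "u \<in> W" "v \<in> W" "u \<noteq> v"
  shows "sink_graph_mult adj W (Some u) (Some v) = (if adj u v then 1 else 0)"
proof -
  have "{(x, y). adj x y \<and> collapse W x = Some u \<and> collapse W y = Some v} =
      (if adj u v then {(u, v)} else {})"
    using assms by (auto simp: collapse_def split: if_splits)
  then show ?thesis using assms by (simp add: sink_graph_mult_def)
qed

lemma sink_graph_mult_None:
  assumes "u \<in> W"
  shows "sink_graph_mult adj W (Some u) None = card {y. adj u y \<and> y \<notin> W}"
proof -
  have "{(x, y). adj x y \<and> collapse W x = Some u \<and> collapse W y = None} =
      Pair u ` {y. adj u y \<and> y \<notin> W}"
    using assms by (auto simp: collapse_def split: if_splits)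
  then show ?thesis
    by (simp add: sink_graph_mult_def card_image inj_on_def)
qed

text \<open>The edges to the sink make up exactly for the neighbours outside \<open>W\<close>, so the stability threshold
  is the same in the finite graph and in the infinite one. This is what lets legal sequences move
  between the two.\<close>

lemma sink_graph_deg_eq:
  assumes "finite W" "v \<in> W"
  shows "sink_graph_deg adj W v = deg v"
proof -
  have "sink_graph_deg adj W v = card {y. adj v y \<and> y \<notin> W} +
      (\<Sum>u\<in>W. sink_graph_mult adj W (Some v) (Some u))"
    unfolding sink_graph_deg_def using assms
    by (subst sum.insert) (auto simp: sum.reindex sink_graph_mult_None)
  also have "(\<Sum>u\<in>W. sink_graph_mult adj W (Some v) (Some u)) = (\<Sum>u\<in>W. if adj v u then 1 else 0)"
    using assms sink_graph_mult_Some adj_irrefl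
    by (intro sum.cong) (auto simp: sink_graph_mult_def)
  also have "\<dots> = card {y. adj v y \<and> y \<in> W}"
    using assms by (simp add: sum.If_cases Int_def conj_commute)
  also have "card {y. adj v y \<and> y \<notin> W} + \<dots> = card ({y. adj v y \<and> y \<notin> W} \<union> {y. adj v y \<and> y \<in> W})"
    using finite_nbrs[of v] by (subst card_Un_disjoint) auto
  also have "{y. adj v y \<and> y \<notin> W} \<union> {y. adj v y \<and> y \<in> W} = {y. adj v y}" by auto
  finally show ?thesis .
qed

lemma lap_eq:
  assumes "finite W" "u \<in> W"
  shows "lap adj W f u = int (deg u) * f u - (\<Sum>v | adj u v \<and> v \<in> W. f v)"
proof -
  have "lap adj W f u = (\<Sum>y\<in>W. lap_entry adj W u y * f y)"
    using assms by (simp add: lap_def)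
  also have "\<dots> = (\<Sum>y\<in>W. (if u = y then int (deg u) * f y else 0) - (if adj u y then f y else 0))"
    using assms adj_irrefl
    by (intro sum.cong) (auto simp: lap_entry_def sink_graph_deg_eq sink_graph_mult_Some)
  also have "\<dots> = int (deg u) * f u - (\<Sum>y\<in>W. if adj u y then f y else 0)"
    using assms by (simp add: sum_subtractf)
  also have "(\<Sum>y\<in>W. if adj u y then f y else 0) = (\<Sum>v | adj u v \<and> v \<in> W. f v)"
    using assms by (simp add: sum.If_cases Int_def conj_commute)
  finally show ?thesis .
qed

lemma fold_topple_eq_lap:
  assumes "finite W" "u \<in> W" "set vs \<subseteq> W" "legal_sequence adj \<sigma> vs"
  shows "int (fold (topple adj) vs \<sigma> u) = int (\<sigma> u) - lap adj W (\<lambda>v. int (count_list vs v)) u"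
proof -
  have "(\<Sum>v | adj u v. int (count_list vs v)) = (\<Sum>v | adj u v \<and> v \<in> W. int (count_list vs v))"
    using assms finite_nbrs[of u] by (intro sum.mono_neutral_right) (auto simp: count_list_0_iff)
  then show ?thesis
    using fold_topple_eq[OF assms(4), of u] assms by (simp add: lap_eq)
qed

text \<open>Toppling in the finite graph is toppling in the infinite graph followed by forgetting the heights
  outside \<open>W\<close>.\<close>

lemma legal_topple_iff:
  assumes "finite W"
  shows "legal_topple adj W \<sigma> \<tau> \<longleftrightarrow>
    \<sigma> \<in> sandpiles W \<and> (\<exists>v\<in>W. deg v \<le> \<sigma> v \<and> \<tau> = restrict (topple adj v \<sigma>) W)"
proof -
  have "(\<tau> \<in> sandpiles W \<and>
          (\<forall>u\<in>W. int (\<tau> u) = int (\<sigma> u) - lap adj W (\<lambda>y. int (unit_mass v y)) u)) \<longleftrightarrow>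
        \<tau> = restrict (topple adj v \<sigma>) W"
    if v: "v \<in> W" "deg v \<le> \<sigma> v" for v
  proof -
    have "(\<lambda>y. int (unit_mass v y)) = (\<lambda>y. int (count_list [v] y))"
      by (auto simp: unit_mass_def)
    then have "int (topple adj v \<sigma> u) = int (\<sigma> u) - lap adj W (\<lambda>y. int (unit_mass v y)) u"
      if "u \<in> W" for u
      using fold_topple_eq_lap[OF assms that, of "[v]" \<sigma>] v by simp
    then show ?thesis
      by (fastforce simp: sandpiles_def PiE_def extensional_def fun_eq_iff)
  qed
  then show ?thesis
    unfolding legal_topple_def using assms by (auto simp: sink_graph_deg_eq)
qed

end

section \<open>Abstract rewriting\<close>

lemma rtranclp_last_step: "r\<^sup>*\<^sup>* x y \<Longrightarrow> y = x \<or> (\<exists>z. r z y)"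
  by (induction rule: rtranclp_induct) auto

text \<open>Existence and uniqueness of normal forms, for an arbitrary relation on an arbitrary type; both are
  later used for the toppling relation on sandpiles.\<close>

lemma normal_form_exists:
  assumes "wfp r\<inverse>\<inverse>"
  shows "\<exists>y. r\<^sup>*\<^sup>* x y \<and> (\<nexists>z. r y z)"
  using assms
proof (induction x rule: wfp_induct_rule)
  case (less x)
  show ?case
  proof (cases "\<exists>z. r x z")
    case True
    then obtain z where z: "r x z" by blast
    then obtain y where "r\<^sup>*\<^sup>* z y" "\<nexists>z. r y z" using less.IH[of z] by auto
    then show ?thesis using z converse_rtranclp_into_rtranclp[of r x z y] by blast
  qed auto
qed

lemma normal_form_unique:
  assumes "strong_confluentp r"
    and "r\<^sup>*\<^sup>* x y" "\<nexists>z. r y z" and "r\<^sup>*\<^sup>* x y'" "\<nexists>z. r y' z"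
  shows "y = y'"
proof -
  obtain u where u: "r\<^sup>*\<^sup>* y u" "r\<^sup>*\<^sup>* y' u"
    using confluentpD[OF strong_confluentp_imp_confluentp] assms by metis
  then have "u = y" "u = y'" using assms(3,5) converse_rtranclpE[of r] by metis+
  then show ?thesis by simp
qed

lemma rtranclp_map:
  assumes "\<And>x y. r x y \<Longrightarrow> r (f x) (f y)" "r\<^sup>*\<^sup>* x y"
  shows "r\<^sup>*\<^sup>* (f x) (f y)"
  using assms(2) by (induction rule: rtranclp_induct) (auto intro: assms(1) rtranclp.rtrancl_into_rtrancl)

section \<open>Stabilization in a finite domain\<close>

locale sandpile_domain = locally_finite_graph adj for adj :: "'v \<Rightarrow> 'v \<Rightarrow> bool" +
  fixes W :: "'v set"
  assumes connected: "adj\<^sup>*\<^sup>* x y"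
    and infinite_vertices: "infinite (UNIV :: 'v set)"
    and finite_W: "finite W"
begin

text \<open>The weight that makes toppling terminate: strictly superharmonic on \<open>W\<close>, zero outside. It is a
  function of the number \<open>esc v\<close> of steps from \<open>v\<close> to the complement of \<open>W\<close>, with increments
  decreasing by a factor \<open>D\<close> that bounds the degrees. Every vertex of \<open>W\<close> has a neighbour closer to
  the complement, and the weight drops more towards this neighbour than it rises towards all the
  others together.\<close>

lemma exists_superharmonic:
  obtains h :: "'v \<Rightarrow> nat"
  where "\<And>v. v \<notin> W \<Longrightarrow> h v = 0" "\<And>v. v \<in> W \<Longrightarrow> (\<Sum>u | adj v u. h u) < deg v * h v"
proof -
  define esc where "esc v = (LEAST k. \<exists>z. z \<notin> W \<and> (adj ^^ k) v z)" for v
  obtain z0 where z0: "z0 \<notin> W" using infinite_vertices finite_W ex_new_if_finite by metis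
  have ex: "\<exists>k z. z \<notin> W \<and> (adj ^^ k) v z" for v
    using connected[of v z0] z0 rtranclp_imp_relpowp by metis
  have esc: "\<exists>z. z \<notin> W \<and> (adj ^^ esc v) v z" for v
    unfolding esc_def using ex[of v] by (rule LeastI_ex)
  have esc_le: "esc v \<le> k" if "z \<notin> W" "(adj ^^ k) v z" for v k z
    unfolding esc_def using that by (intro Least_le) auto
  have esc_out: "esc v = 0" if "v \<notin> W" for v
    using esc_le[of v 0 v] that by simp
  have esc_nbr: "esc u \<le> Suc (esc v)" if "adj v u" for u v
  proof -
    obtain z where "z \<notin> W" "(adj ^^ esc v) v z" using esc by blast
    then show ?thesis using esc_le relpowp_Suc_I2[of adj u v "esc v" z] adj_sym[OF that] by blast
  qed
  have esc_in: "\<exists>k u. esc v = Suc k \<and> adj v u \<and> esc u \<le> k" if v: "v \<in> W" for v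
  proof -
    obtain z where z: "z \<notin> W" "(adj ^^ esc v) v z" using esc by blast
    show ?thesis
    proof (cases "esc v")
      case 0
      then show ?thesis using z v by auto
    next
      case (Suc k)
      then obtain u where "adj v u" "(adj ^^ k) u z"
        using z relpowp_Suc_D2 by metis
      then show ?thesis using Suc z esc_le by blast
    qed
  qed
  define K where "K = Max (insert 0 (esc ` W))"
  define D where "D = Max (insert 1 (deg ` W))"
  have K: "esc v \<le> K" if "v \<in> W" for v
    unfolding K_def using that finite_W by (intro Max_ge) auto
  have D: "deg v \<le> D" if "v \<in> W" for v
    unfolding D_def using that finite_W by (intro Max_ge) auto
  have D1: "1 \<le> D" unfolding D_def using finite_W by (intro Max_ge) auto
  define H where "H j = (\<Sum>i<j. D ^ (K - i))" for j :: nat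
  have H_mono: "H i \<le> H j" if "i \<le> j" for i j
    unfolding H_def using that by (intro sum_mono2) auto
  have "(\<Sum>u | adj v u. H (esc u)) < deg v * H (esc v)" if v: "v \<in> W" for v
  proof -
    obtain k u0 where k: "esc v = Suc k" "adj v u0" "esc u0 \<le> k" using esc_in[OF v] by blast
    define j where "j = K - Suc k"
    have j: "K - k = Suc j" unfolding j_def using K[OF v] k by simp
    let ?N = "{u. adj v u}"
    have fin: "finite ?N" by (rule finite_nbrs)
    have dv: "deg v = Suc (card (?N - {u0}))"
      using fin k(2) by (intro card.remove) auto
    have "(\<Sum>u\<in>?N. H (esc u)) = H (esc u0) + (\<Sum>u\<in>?N - {u0}. H (esc u))"
      using fin k by (intro sum.remove) auto
    also have "\<dots> \<le> H k + (\<Sum>u\<in>?N - {u0}. H (Suc (Suc k)))"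
      using k esc_nbr[of v] by (intro add_mono sum_mono H_mono) auto
    also have "\<dots> = H k + card (?N - {u0}) * H (Suc (Suc k))" by simp
    also have "H (Suc (Suc k)) = H (Suc k) + D ^ j" unfolding H_def j_def by simp
    also have "H k + card (?N - {u0}) * (H (Suc k) + D ^ j)
        < H k + D ^ Suc j + card (?N - {u0}) * H (Suc k)"
    proof -
      have "card (?N - {u0}) * D ^ j < D * D ^ j"
        using D[OF v] dv D1 by (intro mult_strict_right_mono) auto
      then show ?thesis by (simp add: algebra_simps)
    qed
    also have "H k + D ^ Suc j = H (Suc k)" unfolding H_def j[symmetric] by simp
    finally show ?thesis unfolding dv k(1) by simp
  qed
  then show ?thesis using that[of "\<lambda>v. H (esc v)"] esc_out by (simp add: H_def)
qed

lemmas legal_topple_iff' = legal_topple_iff[OF finite_W]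

text \<open>A toppling at \<open>v\<close> changes the total weight of the grains by the sum of the weights of the
  neighbours of \<open>v\<close> minus \<open>deg v\<close> times the weight of \<open>v\<close>, which is negative.\<close>

lemma wf_legal_topple: "wfp (legal_topple adj W)\<inverse>\<inverse>"
proof -
  obtain h :: "'v \<Rightarrow> nat" where h: "\<And>v. v \<notin> W \<Longrightarrow> h v = 0"
    "\<And>v. v \<in> W \<Longrightarrow> (\<Sum>u | adj v u. h u) < deg v * h v"
    using exists_superharmonic by blast
  have "(\<Sum>u\<in>W. h u * \<tau> u) < (\<Sum>u\<in>W. h u * \<sigma> u)" if step: "legal_topple adj W \<sigma> \<tau>" for \<sigma> \<tau>
  proof -
    obtain v where v: "v \<in> W" "deg v \<le> \<sigma> v" "\<tau> = restrict (topple adj v \<sigma>) W"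
      using step legal_topple_iff' by blast
    have "int (h u * \<tau> u) = int (h u * \<sigma> u) - (if u = v then int (deg v * h v) else 0)
        + (if adj v u then int (h u) else 0)" if "u \<in> W" for u
      using v that adj_irrefl[of v] by (auto simp: topple_def algebra_simps of_nat_diff)
    then have "int (\<Sum>u\<in>W. h u * \<tau> u) = (\<Sum>u\<in>W. int (h u * \<sigma> u)
        - (if u = v then int (deg v * h v) else 0) + (if adj v u then int (h u) else 0))"
      by simp
    also have "\<dots> = int (\<Sum>u\<in>W. h u * \<sigma> u) - int (deg v * h v)
        + (\<Sum>u\<in>W. if adj v u then int (h u) else 0)"
      using v finite_W by (simp add: sum.distrib sum_subtractf)
    also have "(\<Sum>u\<in>W. if adj v u then int (h u) else 0) = (\<Sum>u | adj v u \<and> u \<in> W. int (h u))"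
      using finite_W by (simp add: sum.If_cases Int_def conj_commute)
    also have "\<dots> = (\<Sum>u | adj v u. int (h u))"
      using h(1) finite_nbrs[of v] by (intro sum.mono_neutral_left) auto
    also have "\<dots> = int (\<Sum>u | adj v u. h u)" by simp
    finally show ?thesis using h(2)[OF v(1)] by linarith
  qed
  then show ?thesis
    by (intro wfp_if_convertible_to_nat[of _ "\<lambda>\<sigma>. \<Sum>u\<in>W. h u * \<sigma> u"]) (simp only: conversep_iff)
qed

lemma legal_topple_sandpiles: "legal_topple adj W \<sigma> \<tau> \<Longrightarrow> \<tau> \<in> sandpiles W"
  by (simp add: legal_topple_def)

lemma legal_topples_sandpiles:
  assumes "(legal_topple adj W)\<^sup>*\<^sup>* \<sigma> \<tau>" "\<sigma> \<in> sandpiles W"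
  shows "\<tau> \<in> sandpiles W"
  using rtranclp_last_step[OF assms(1)] assms(2) legal_topple_sandpiles by blast

lemma stable_iff:
  "\<tau> \<in> stable_sandpiles adj W \<longleftrightarrow> \<tau> \<in> sandpiles W \<and> (\<forall>v\<in>W. \<tau> v < deg v)"
  by (simp add: stable_sandpiles_def sink_graph_deg_eq finite_W)

lemma stable_iff_normal:
  assumes "\<tau> \<in> sandpiles W"
  shows "\<tau> \<in> stable_sandpiles adj W \<longleftrightarrow> (\<nexists>\<tau>'. legal_topple adj W \<tau> \<tau>')"
proof -
  have "(\<exists>\<tau>'. legal_topple adj W \<tau> \<tau>') \<longleftrightarrow> (\<exists>v\<in>W. deg v \<le> \<tau> v)"
    unfolding legal_topple_iff' using assms by blast
  then show ?thesis unfolding stable_iff using assms by (simp add: Ball_def Bex_def not_le)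
qed

text \<open>Topplings at distinct vertices do not disable each other and commute.\<close>

lemma strong_confluentp_legal_topple: "strong_confluentp (legal_topple adj W)"
proof (rule strong_confluentpI)
  fix \<sigma> \<alpha> \<beta>
  assume "legal_topple adj W \<sigma> \<alpha>" "legal_topple adj W \<sigma> \<beta>"
  then obtain v w where v: "v \<in> W" "deg v \<le> \<sigma> v" "\<alpha> = restrict (topple adj v \<sigma>) W"
    and w: "w \<in> W" "deg w \<le> \<sigma> w" "\<beta> = restrict (topple adj w \<sigma>) W"
    and \<sigma>: "\<sigma> \<in> sandpiles W" "\<alpha> \<in> sandpiles W" "\<beta> \<in> sandpiles W"
    using legal_topple_iff' legal_topple_sandpiles by metis
  show "\<exists>u. (legal_topple adj W)\<^sup>*\<^sup>* \<alpha> u \<and> (legal_topple adj W)\<^sup>=\<^sup>= \<beta> u"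
  proof (cases "v = w")
    case True
    then show ?thesis using v w by auto
  next
    case False
    define \<gamma> where "\<gamma> = restrict (topple adj w (topple adj v \<sigma>)) W"
    have "\<gamma> = restrict (topple adj w \<alpha>) W"
      unfolding \<gamma>_def v(3) using topple_agree[of W "topple adj v \<sigma>" "restrict (topple adj v \<sigma>) W" adj w]
      by (auto simp: restrict_def fun_eq_iff)
    moreover have "deg w \<le> \<alpha> w" using False v w by (auto simp: topple_def)
    ultimately have "legal_topple adj W \<alpha> \<gamma>" using w \<sigma> legal_topple_iff' by blast
    have "\<gamma> = restrict (topple adj v \<beta>) W"
      unfolding \<gamma>_def w(3) topple_commute[OF False v(2) w(2), symmetric]
      using topple_agree[of W "topple adj w \<sigma>" "restrict (topple adj w \<sigma>) W" adj v]
      by (auto simp: restrict_def fun_eq_iff)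
    moreover have "deg v \<le> \<beta> v" using False v w by (auto simp: topple_def)
    ultimately have "legal_topple adj W \<beta> \<gamma>" using v \<sigma> legal_topple_iff' by blast
    then show ?thesis using \<open>legal_topple adj W \<alpha> \<gamma>\<close> by blast
  qed
qed

lemma stabilization_exists:
  assumes "\<sigma> \<in> sandpiles W"
  shows "\<exists>\<tau>. \<tau> \<in> stable_sandpiles adj W \<and> (legal_topple adj W)\<^sup>*\<^sup>* \<sigma> \<tau>"
proof -
  obtain \<tau> where \<tau>: "(legal_topple adj W)\<^sup>*\<^sup>* \<sigma> \<tau>" "\<nexists>\<tau>'. legal_topple adj W \<tau> \<tau>'"
    using normal_form_exists[OF wf_legal_topple, of \<sigma>] by (elim exE conjE)
  have "\<tau> \<in> stable_sandpiles adj W"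
    using \<tau>(2) stable_iff_normal[OF legal_topples_sandpiles[OF \<tau>(1) assms]] by simp
  then show ?thesis using \<tau>(1) by (intro exI[of _ \<tau>] conjI)
qed

lemma stable_unique:
  assumes "\<sigma> \<in> sandpiles W"
    and "(legal_topple adj W)\<^sup>*\<^sup>* \<sigma> \<tau>" "\<tau> \<in> stable_sandpiles adj W"
    and "(legal_topple adj W)\<^sup>*\<^sup>* \<sigma> \<tau>'" "\<tau>' \<in> stable_sandpiles adj W"
  shows "\<tau> = \<tau>'"

proof -
  note a = normal_form_unique[OF strong_confluentp_legal_topple, of \<sigma> \<tau> \<tau>']
  have n: "\<nexists>z. legal_topple adj W \<tau> z"
    using stable_iff_normal[of \<tau>] assms(3) by (simp add: stable_iff)
  have n': "\<nexists>z. legal_topple adj W \<tau>' z"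
    using stable_iff_normal[of \<tau>'] assms(5) by (simp add: stable_iff)
  show ?thesis by (rule a[OF assms(2) n assms(4) n'])
qed
lemma stabilization_eqI:
  assumes "\<sigma> \<in> sandpiles W" "(legal_topple adj W)\<^sup>*\<^sup>* \<sigma> \<tau>" "\<tau> \<in> stable_sandpiles adj W"
  shows "stabilization adj W \<sigma> = \<tau>"
  unfolding stabilization_def
  by (rule the_equality) (use assms in \<open>auto intro: stable_unique[OF assms(1)]\<close>)

lemma stabilization:
  assumes "\<sigma> \<in> sandpiles W"
  shows "stabilization adj W \<sigma> \<in> stable_sandpiles adj W"
    and "(legal_topple adj W)\<^sup>*\<^sup>* \<sigma> (stabilization adj W \<sigma>)"
proof -
  obtain \<tau> where \<tau>: "\<tau> \<in> stable_sandpiles adj W" "(legal_topple adj W)\<^sup>*\<^sup>* \<sigma> \<tau>"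
    using stabilization_exists[OF assms] by (elim exE conjE)
  with stabilization_eqI[OF assms \<tau>(2,1)]
  show "stabilization adj W \<sigma> \<in> stable_sandpiles adj W"
    "(legal_topple adj W)\<^sup>*\<^sup>* \<sigma> (stabilization adj W \<sigma>)" by simp_all
qed

lemma stabilization_legal_topples:
  assumes "\<sigma> \<in> sandpiles W" "(legal_topple adj W)\<^sup>*\<^sup>* \<sigma> \<tau>"
  shows "stabilization adj W \<sigma> = stabilization adj W \<tau>"
  using assms(2) stabilization[OF legal_topples_sandpiles[OF assms(2,1)]]
  by (intro stabilization_eqI[OF assms(1)]) (auto intro: rtranclp_trans[of "legal_topple adj W" \<sigma> \<tau>])

section \<open>Adding grains\<close>

definition add_grains :: "('v \<Rightarrow> nat) \<Rightarrow> ('v \<Rightarrow> nat) \<Rightarrow> 'v \<Rightarrow> nat" where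
  "add_grains \<sigma> g = (\<lambda>v\<in>W. \<sigma> v + g v)"

text \<open>The configurations reached by the Markov chain from a stable \<open>\<sigma>\<close> are exactly those of
  the form \<open>drive g \<sigma>\<close>, so recurrence becomes a question about this action of the monoid of
  additions.\<close>

definition drive :: "('v \<Rightarrow> nat) \<Rightarrow> ('v \<Rightarrow> nat) \<Rightarrow> 'v \<Rightarrow> nat" where
  "drive g \<sigma> = stabilization adj W (add_grains \<sigma> g)"

lemma add_grains_sandpiles [simp]: "add_grains \<sigma> g \<in> sandpiles W"
  by (simp add: add_grains_def sandpiles_def)

lemma add_grains_add_grains:
  "add_grains (add_grains \<sigma> f) g = add_grains \<sigma> (\<lambda>v. f v + g v)"
  by (auto simp: add_grains_def)

lemma legal_topple_add_grains:
  assumes "legal_topple adj W \<sigma> \<tau>"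
  shows "legal_topple adj W (add_grains \<sigma> g) (add_grains \<tau> g)"
proof -
  obtain v where v: "v \<in> W" "deg v \<le> \<sigma> v" "\<tau> = restrict (topple adj v \<sigma>) W"
    using assms legal_topple_iff' by blast
  have "add_grains \<tau> g = restrict (topple adj v (add_grains \<sigma> g)) W"
    unfolding v(3) add_grains_def using v by (auto simp: topple_def fun_eq_iff)
  moreover have "deg v \<le> add_grains \<sigma> g v" using v by (simp add: add_grains_def)
  ultimately show ?thesis using v(1) legal_topple_iff' by auto
qed

lemma legal_topples_add_grains:
  "(legal_topple adj W)\<^sup>*\<^sup>* \<sigma> \<tau> \<Longrightarrow>
    (legal_topple adj W)\<^sup>*\<^sup>* (add_grains \<sigma> g) (add_grains \<tau> g)"
  by (rule rtranclp_map[where r = "legal_topple adj W" and f = "\<lambda>\<sigma>. add_grains \<sigma> g"])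
    (rule legal_topple_add_grains)

lemma drive_stable [simp]: "drive g \<sigma> \<in> stable_sandpiles adj W"
  unfolding drive_def by (simp add: stabilization)

text \<open>The abelian property: stabilizing early does not matter, because legal topplings stay legal in
  the presence of more grains.\<close>

lemma drive_drive: "drive g (drive f \<sigma>) = drive (\<lambda>v. f v + g v) \<sigma>"
proof -
  have "(legal_topple adj W)\<^sup>*\<^sup>* (add_grains (add_grains \<sigma> f) g) (add_grains (drive f \<sigma>) g)"
    unfolding drive_def by (intro legal_topples_add_grains stabilization) simp
  then show ?thesis
    unfolding drive_def[of g] drive_def[of "\<lambda>v. f v + g v"] add_grains_add_grains[symmetric]
    by (intro stabilization_legal_topples[symmetric]) simp_all
qed

lemma drive_cong: "(\<And>v. v \<in> W \<Longrightarrow> f v = g v) \<Longrightarrow> drive f \<sigma> = drive g \<sigma>"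
  unfolding drive_def add_grains_def by (simp cong: restrict_cong)

lemma drive_0:
  assumes "\<sigma> \<in> stable_sandpiles adj W"
  shows "drive (\<lambda>v. 0) \<sigma> = \<sigma>"
proof -
  have "add_grains \<sigma> (\<lambda>v. 0) = \<sigma>"
    using assms by (auto simp: add_grains_def stable_iff sandpiles_def PiE_def extensional_def fun_eq_iff)
  then show ?thesis unfolding drive_def using assms stable_iff by (intro stabilization_eqI) auto
qed

lemma drive_funpow:
  assumes "\<sigma> \<in> stable_sandpiles adj W"
  shows "(drive g ^^ n) \<sigma> = drive (\<lambda>v. n * g v) \<sigma>"
  by (induction n) (simp_all add: drive_0 assms drive_drive add.commute)

lemma finite_stable: "finite (stable_sandpiles adj W)"
proof (rule finite_subset)
  show "stable_sandpiles adj W \<subseteq> (\<Pi>\<^sub>E v\<in>W. {..<deg v})"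
    by (auto simp: stable_iff sandpiles_def PiE_iff extensional_def)
  show "finite (\<Pi>\<^sub>E v\<in>W. {..<deg v})" using finite_W by (intro finite_PiE) auto
qed

lemma sandpile_chain_eq:
  assumes "\<sigma> \<in> stable_sandpiles adj W"
  shows "sandpile_chain adj W \<sigma> Y k = drive (\<lambda>v. \<Sum>i<k. unit_mass (Y i) v) \<sigma>"
proof (induction k)
  case (Suc k)
  have "sandpile_chain adj W \<sigma> Y (Suc k) = drive (unit_mass (Y k)) (sandpile_chain adj W \<sigma> Y k)"
    by (simp add: drive_def add_grains_def)
  then show ?case unfolding Suc drive_drive by (simp add: add.commute)
qed (simp add: drive_0 assms)

text \<open>If every vertex already holds all the grains that it is going to give away, then the prescribed
  topplings are legal in any order.\<close>

lemma legal_firing: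
  assumes "\<sigma> \<in> sandpiles W" "\<tau> \<in> sandpiles W"
    and "\<And>u. u \<in> W \<Longrightarrow> int (\<tau> u) = int (\<sigma> u) - lap adj W (\<lambda>v. int (f v)) u"
    and "\<And>u. u \<in> W \<Longrightarrow> deg u * f u \<le> \<sigma> u"
  shows "(legal_topple adj W)\<^sup>*\<^sup>* \<sigma> \<tau>"
  using assms
proof (induction "\<Sum>v\<in>W. f v" arbitrary: f \<sigma>)
  case 0
  then have f: "f v = 0" if "v \<in> W" for v using that finite_W by simp
  have "lap adj W (\<lambda>v. int (f v)) u = 0" if "u \<in> W" for u
    using that f by (simp add: lap_eq finite_W)
  then have "\<tau> u = \<sigma> u" if "u \<in> W" for u using 0(4)[OF that] that by simp
  then have "\<tau> = \<sigma>" using 0(2,3) unfolding sandpiles_def by (intro PiE_ext) auto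
  then show ?case by simp
next
  case (Suc n)
  obtain v where v: "v \<in> W" "f v > 0"
  proof (rule ccontr)
    assume "\<not> thesis"
    with that have "f v = 0" if "v \<in> W" for v using \<open>v \<in> W\<close> by blast
    then show False using Suc.hyps(2) by simp
  qed
  define f' where "f' = f(v := f v - 1)"
  define \<sigma>' where "\<sigma>' = restrict (topple adj v \<sigma>) W"
  have dv: "deg v * f v \<le> \<sigma> v" using Suc.prems(4) v by blast
  moreover have "deg v \<le> deg v * f v" using v by simp
  ultimately have "deg v \<le> \<sigma> v" by (rule le_trans[rotated])
  then have step: "legal_topple adj W \<sigma> \<sigma>'"
    unfolding \<sigma>'_def using v Suc.prems legal_topple_iff' by blast
  have "n = (\<Sum>v\<in>W. f' v)"
  proof -
    have "(\<Sum>v\<in>W. f v) = f v + (\<Sum>u\<in>W - {v}. f u)" "(\<Sum>v\<in>W. f' v) = f' v + (\<Sum>u\<in>W - {v}. f' u)"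
      using v finite_W by (auto intro: sum.remove)
    moreover have "(\<Sum>u\<in>W - {v}. f' u) = (\<Sum>u\<in>W - {v}. f u)" unfolding f'_def by (rule sum.cong) auto
    ultimately show ?thesis using Suc.hyps(2) v unfolding f'_def by simp
  qed
  moreover have "int (\<tau> u) = int (\<sigma>' u) - lap adj W (\<lambda>v. int (f' v)) u" if "u \<in> W" for u
  proof -
    have "(\<lambda>w. int (f w)) = (\<lambda>w. int (f' w) + int (unit_mass v w))"
      using v by (auto simp: f'_def unit_mass_def)
    then have "lap adj W (\<lambda>w. int (f w)) u =
        lap adj W (\<lambda>w. int (f' w)) u + lap adj W (\<lambda>w. int (unit_mass v w)) u"
      using that by (simp add: lap_eq finite_W sum.distrib algebra_simps)
    moreover have "(\<lambda>y. int (unit_mass v y)) = (\<lambda>y. int (count_list [v] y))"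
      by (auto simp: unit_mass_def)
    then have "int (\<sigma>' u) = int (\<sigma> u) - lap adj W (\<lambda>y. int (unit_mass v y)) u"
      using fold_topple_eq_lap[OF finite_W that, of "[v]" \<sigma>] v \<open>deg v \<le> \<sigma> v\<close> that
      by (simp add: \<sigma>'_def)
    ultimately show ?thesis using Suc.prems(3)[OF that] by simp
  qed
  moreover have "deg u * f' u \<le> \<sigma>' u" if "u \<in> W" for u
  proof (cases "u = v")
    case True
    then show ?thesis using dv v by (auto simp: f'_def \<sigma>'_def topple_def diff_mult_distrib2)
  next
    case False
    then have "\<sigma> u \<le> \<sigma>' u" using that by (auto simp: \<sigma>'_def topple_def)
    then show ?thesis using False Suc.prems(4)[OF that] by (simp add: f'_def)
  qed
  ultimately have "(legal_topple adj W)\<^sup>*\<^sup>* \<sigma>' \<tau>"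
    by (intro Suc.hyps(1)[OF _ legal_topple_sandpiles[OF step] Suc.prems(2)])
  then show ?case using step converse_rtranclp_into_rtranclp[of "legal_topple adj W" \<sigma> \<sigma>' \<tau>] by (simp only:)
qed

lemma legal_topples_sequence:
  assumes "(legal_topple adj W)\<^sup>*\<^sup>* \<sigma> \<tau>" "\<sigma> \<in> sandpiles W"
  shows "\<exists>vs. set vs \<subseteq> W \<and> legal_sequence adj \<sigma> vs \<and> \<tau> = restrict (fold (topple adj) vs \<sigma>) W"
  using assms
proof (induction rule: rtranclp_induct)
  case base
  then show ?case
    by (intro exI[of _ "[]"]) (auto simp: sandpiles_def PiE_def extensional_restrict)
next
  case (step \<tau> \<rho>)
  then obtain vs where vs: "set vs \<subseteq> W" "legal_sequence adj \<sigma> vs"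
    "\<tau> = restrict (fold (topple adj) vs \<sigma>) W" by blast
  obtain v where v: "v \<in> W" "deg v \<le> \<tau> v" "\<rho> = restrict (topple adj v \<tau>) W"
    using step legal_topple_iff' by blast
  have "\<rho> = restrict (fold (topple adj) (vs @ [v]) \<sigma>) W"
    unfolding v(3) vs(3) using topple_agree[of W "fold (topple adj) vs \<sigma>" "restrict (fold (topple adj) vs \<sigma>) W" adj v]
    by (auto simp: restrict_def fun_eq_iff)
  moreover have "legal_sequence adj \<sigma> (vs @ [v])"
    using vs v by (simp add: legal_sequence_append)
  ultimately show ?case using vs(1) v(1) by (intro exI[of _ "vs @ [v]"]) auto
qed

lemma drive_sequence:
  obtains vs where "set vs \<subseteq> W" "legal_sequence adj (add_grains \<sigma> g) vs"
    "\<And>u. u \<in> W \<Longrightarrow> int (drive g \<sigma> u) =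
       int (\<sigma> u) + int (g u) - lap adj W (\<lambda>v. int (count_list vs v)) u"
proof -
  obtain vs where vs: "set vs \<subseteq> W" "legal_sequence adj (add_grains \<sigma> g) vs"
    "drive g \<sigma> = restrict (fold (topple adj) vs (add_grains \<sigma> g)) W"
    using legal_topples_sequence[OF stabilization(2)[OF add_grains_sandpiles] add_grains_sandpiles, of \<sigma> g]
    unfolding drive_def by (elim exE conjE)
  show ?thesis
    by (rule that[OF vs(1,2)])
      (use vs fold_topple_eq_lap[OF finite_W _ vs(1,2)] in \<open>simp add: add_grains_def\<close>)
qed

end

section \<open>Recurrent sandpiles\<close>

text \<open>If the sequence avoids \<open>w\<close>, then both its first \<open>length w\<close> letters differ from \<open>w\<close> and the remaining
  sequence avoids \<open>w\<close>; these two events are independent and the remaining sequence has the original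
  distribution. Hence the probability \<open>p\<close> of avoiding \<open>w\<close> satisfies \<open>p \<le> q * p\<close>,
  where \<open>q < 1\<close> is the probability that the first letters differ from \<open>w\<close>.\<close>

lemma AE_iid_contains_word:
  assumes "set w \<subseteq> set_pmf p"
  shows "AE Y in Pi\<^sub>M (UNIV :: nat set) (\<lambda>_. measure_pmf p). \<exists>k. \<forall>i<length w. Y (k + i) = w ! i"
proof -
  interpret sequence_space "measure_pmf p" by unfold_locales
  let ?m = "length w"
  define B where "B = {Y \<in> space S. \<exists>i<?m. Y i \<noteq> w ! i}"
  define N where "N = {Y \<in> space S. \<forall>k. \<exists>i<?m. Y (k + i) \<noteq> w ! i}"
  have B: "B \<in> sets S" and N: "N \<in> sets S" unfolding B_def N_def by measurable
  have "emeasure S N = emeasure (distr (S \<Otimes>\<^sub>M S) S (\<lambda>(\<omega>, \<omega>'). comb_seq ?m \<omega> \<omega>')) N"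
    by (simp add: PiM_comb_seq)
  also have "\<dots> = emeasure (S \<Otimes>\<^sub>M S) ((\<lambda>(\<omega>, \<omega>'). comb_seq ?m \<omega> \<omega>') -` N \<inter> space (S \<Otimes>\<^sub>M S))"
    using N by (intro emeasure_distr measurable_comb_seq)
  also have "\<dots> \<le> emeasure (S \<Otimes>\<^sub>M S) (B \<times> N)"
  proof (rule emeasure_mono)
    have "a \<in> B \<and> b \<in> N" if "comb_seq ?m a b \<in> N" "a \<in> space S" "b \<in> space S" for a b
    proof -
      have *: "\<exists>i<?m. comb_seq ?m a b (k + i) \<noteq> w ! i" for k using that by (simp add: N_def)
      from *[of 0] have "a \<in> B" using that by (auto simp: B_def comb_seq_def)
      moreover have "\<exists>i<?m. b (k + i) \<noteq> w ! i" for k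
        using *[of "?m + k"] by (auto simp: comb_seq_def add.assoc)
      ultimately show ?thesis using that by (simp add: N_def)
    qed
    then show "(\<lambda>(\<omega>, \<omega>'). comb_seq ?m \<omega> \<omega>') -` N \<inter> space (S \<Otimes>\<^sub>M S) \<subseteq> B \<times> N"
      by (auto simp: space_pair_measure)
  qed (use B N in auto)
  also have "\<dots> = emeasure S B * emeasure S N"
    using B N by (rule P.emeasure_pair_measure_Times)
  finally have le: "P.prob N \<le> P.prob B * P.prob N"
    by (simp add: P.emeasure_eq_measure flip: ennreal_mult)
  have "P.prob B < 1"
  proof -
    have 1: "Y \<in> space S - B \<longleftrightarrow> (\<forall>i<?m. Y i = w ! i)" for Y
      by (simp add: B_def space_PiM)
    have 2: "Y \<in> prod_emb UNIV (\<lambda>_. measure_pmf p) {..<?m} (\<Pi>\<^sub>E i\<in>{..<?m}. {w ! i}) \<longleftrightarrow>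
        (\<forall>i<?m. Y i = w ! i)" for Y
      by (simp add: prod_emb_def space_PiM PiE_iff Ball_def)
    have eq: "space S - B = prod_emb UNIV (\<lambda>_. measure_pmf p) {..<?m} (\<Pi>\<^sub>E i\<in>{..<?m}. {w ! i})"
      unfolding set_eq_iff 1 2 by simp
    have "emeasure S (space S - B) = (\<Prod>i<?m. emeasure (measure_pmf p) {w ! i})"
      unfolding eq by (rule emeasure_PiM_emb) auto
    also have "\<dots> \<noteq> 0"
      using assms by (auto simp: emeasure_pmf_single pmf_eq_0_set_pmf)
    finally have "P.prob (space S - B) > 0"
      by (simp add: P.emeasure_eq_measure zero_less_measure_iff)
    then show ?thesis using P.prob_compl[OF B] by simp
  qed
  then have "P.prob N = 0"
    using le mult_strict_right_mono[of "P.prob B" 1 "P.prob N"] zero_less_measure_iff[of S N] by force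
  then show ?thesis
    using N by (intro AE_I[of _ _ N]) (auto simp: N_def P.emeasure_eq_measure)
qed

context sandpile_domain
begin

lemma obtain_word_with_counts:
  obtains u where "set u \<subseteq> W" "\<And>v. v \<in> W \<Longrightarrow> count_list u v = g v"
proof -
  have "\<exists>u. set u \<subseteq> F \<and> (\<forall>v\<in>F. count_list u v = g v)" if "finite F" for F :: "'v set"
    using that
  proof (induction F)
    case (insert w F)
    then obtain u where u: "set u \<subseteq> F" "\<forall>v\<in>F. count_list u v = g v" by blast
    have "count_list (replicate n w) v = (if v = w then n else 0)" for v :: 'v and n
      by (induction n) auto
    moreover have "count_list u w = 0" using u insert.hyps by (auto simp: count_list_0_iff)
    ultimately show ?case
      using u insert.hyps by (intro exI[of _ "replicate (g w) w @ u"]) (auto split: if_splits)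
  qed simp
  from this[OF finite_W] show ?thesis using that by blast
qed

text \<open>With positive probability the first grain falls on \<open>v\<close>, so an almost surely returning chain has a
  returning trajectory that starts with \<open>v\<close>. Doing one such loop for every \<open>v \<in> W\<close> adds a grain
  everywhere.\<close>

lemma recurrent_imp_drive_fixed:
  assumes "W \<noteq> {}" "\<sigma> \<in> recurrent_sandpiles adj W"
  shows "\<exists>G. (\<forall>v\<in>W. 0 < G v) \<and> drive G \<sigma> = \<sigma>"
proof -
  have stable: "\<sigma> \<in> stable_sandpiles adj W"
    and AE: "AE Y in Pi\<^sub>M (UNIV :: nat set) (\<lambda>_. measure_pmf (pmf_of_set W)).
      \<exists>k>0. sandpile_chain adj W \<sigma> Y k = \<sigma>"
    using assms(2) by (auto simp: recurrent_sandpiles_def)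
  have "\<exists>g. 0 < g v \<and> drive g \<sigma> = \<sigma>" if v: "v \<in> W" for v
  proof (rule ccontr)
    assume no: "\<not> (\<exists>g. 0 < g v \<and> drive g \<sigma> = \<sigma>)"
    have Y0: "Y 0 \<noteq> v" if ret: "\<exists>k>0. sandpile_chain adj W \<sigma> Y k = \<sigma>" for Y
    proof
      assume Y: "Y 0 = v"
      obtain k where k: "k > 0" "sandpile_chain adj W \<sigma> Y k = \<sigma>" using ret by (elim exE conjE)
      have "unit_mass (Y 0) v \<le> (\<Sum>i<k. unit_mass (Y i) v)"
        using k(1) by (intro member_le_sum) auto
      then have "0 < (\<Sum>i<k. unit_mass (Y i) v)" using Y by (simp add: unit_mass_def)
      moreover have "drive (\<lambda>v. \<Sum>i<k. unit_mass (Y i) v) \<sigma> = \<sigma>"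
        using k(2) sandpile_chain_eq[OF stable, of Y k] by simp
      ultimately show False using no by (auto dest!: spec[of _ "\<lambda>v. \<Sum>i<k. unit_mass (Y i) v"])
    qed
    have "AE Y in Pi\<^sub>M (UNIV :: nat set) (\<lambda>_. measure_pmf (pmf_of_set W)). Y 0 \<noteq> v"
      by (rule eventually_mono[OF AE]) (rule Y0)
    then have "AE x in distr (Pi\<^sub>M (UNIV :: nat set) (\<lambda>_. measure_pmf (pmf_of_set W)))
        (measure_pmf (pmf_of_set W)) (\<lambda>Y. Y 0). x \<noteq> v"
      by (subst AE_distr_iff) auto
    then have "AE x in measure_pmf (pmf_of_set W). x \<noteq> v"
      by (subst (asm) distr_PiM_component) (auto simp: measure_pmf.prob_space_axioms)
    then show False using v assms(1) finite_W by (auto simp: AE_measure_pmf_iff)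
  qed
  then obtain g where g: "\<And>v. v \<in> W \<Longrightarrow> 0 < g v v" "\<And>v. v \<in> W \<Longrightarrow> drive (g v) \<sigma> = \<sigma>"
    by metis
  have "drive (\<lambda>u. \<Sum>v\<in>F. g v u) \<sigma> = \<sigma>" if "finite F" "F \<subseteq> W" for F
    using that
  proof (induction F)
    case empty
    then show ?case by (simp add: drive_0 stable)
  next
    case (insert w F)
    then have "drive (\<lambda>u. \<Sum>v\<in>insert w F. g v u) \<sigma> = drive (\<lambda>u. \<Sum>v\<in>F. g v u) (drive (g w) \<sigma>)"
      by (simp add: drive_drive)
    then show ?case using insert g by simp
  qed
  moreover have "0 < (\<Sum>v\<in>W. g v u)" if "u \<in> W" for u
    using g(1)[OF that] member_le_sum[of u W "\<lambda>v. g v u"] that finite_W by force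
  ultimately show ?thesis using finite_W by (intro exI[of _ "\<lambda>u. \<Sum>v\<in>W. g v u"]) auto
qed

text \<open>Enough repetitions of a loop \<open>G\<close> dominate any addition \<open>g\<close>, and what is left over leads back.\<close>

lemma drive_fixed_returns:
  assumes "\<sigma> \<in> stable_sandpiles adj W" "drive G \<sigma> = \<sigma>" "\<And>v. v \<in> W \<Longrightarrow> 0 < G v"
  shows "\<exists>n. (\<forall>v\<in>W. g v \<le> n * G v) \<and> drive (\<lambda>v. n * G v - g v) (drive g \<sigma>) = \<sigma>"
proof -
  define n where "n = (\<Sum>v\<in>W. g v)"
  have n: "g v \<le> n * G v" if "v \<in> W" for v
  proof -
    have "g v \<le> n" unfolding n_def using that finite_W by (intro member_le_sum) auto
    also have "n \<le> n * G v" using assms(3)[OF that] by simp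
    finally show ?thesis .
  qed
  have "drive (\<lambda>v. n * G v - g v) (drive g \<sigma>) = drive (\<lambda>v. n * G v) \<sigma>"
    unfolding drive_drive using n by (intro drive_cong) simp
  also have "\<dots> = (drive G ^^ n) \<sigma>" using drive_funpow[OF assms(1)] by simp
  also have "\<dots> = \<sigma>" using assms(2) by (induction n) simp_all
  finally show ?thesis using n by blast
qed

text \<open>One can return to \<open>\<sigma>\<close> from each of the finitely many states \<open>R\<close> that are reachable from it.
  Concatenating return words gives a single word that passes through \<open>\<sigma>\<close> from whatever state in
  \<open>R\<close> it is read, and almost surely the driving sequence contains this word.\<close>

lemma drive_fixed_imp_recurrent:
  assumes ne: "W \<noteq> {}" and stable: "\<sigma> \<in> stable_sandpiles adj W"
    and G: "drive G \<sigma> = \<sigma>" "\<And>v. v \<in> W \<Longrightarrow> 0 < G v"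
  shows "\<sigma> \<in> recurrent_sandpiles adj W"
proof -
  define R where "R = range (\<lambda>g. drive g \<sigma>)"
  have R_back: "\<exists>g. drive g \<tau> = \<sigma>" if "\<tau> \<in> R" for \<tau>
    using that drive_fixed_returns[OF stable G] unfolding R_def by blast
  have R_drive: "drive g \<tau> \<in> R" if "\<tau> \<in> R" for g \<tau>
    using that unfolding R_def by (auto simp: drive_drive)
  have "finite R" unfolding R_def by (rule finite_subset[OF _ finite_stable]) auto
  \<comment> \<open>A new state \<open>\<tau>\<close> is treated by appending a return word for the state to which \<open>\<tau>\<close> is led by
    the word found so far.\<close>
  have "\<exists>w. set w \<subseteq> W \<and> (\<forall>\<tau>\<in>F. \<exists>j\<le>length w. drive (count_list (take j w)) \<tau> = \<sigma>)"
    if "finite F" "F \<subseteq> R" for F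
    using that
  proof (induction F)
    case (insert \<tau> F)
    then obtain w where w: "set w \<subseteq> W"
      "\<And>\<rho>. \<rho> \<in> F \<Longrightarrow> \<exists>j\<le>length w. drive (count_list (take j w)) \<rho> = \<sigma>" by blast
    have "drive (count_list w) \<tau> \<in> R" using R_drive insert.prems by blast
    then obtain g where g: "drive g (drive (count_list w) \<tau>) = \<sigma>" using R_back by blast
    obtain u where u: "set u \<subseteq> W" "\<And>v. v \<in> W \<Longrightarrow> count_list u v = g v"
      using obtain_word_with_counts by metis
    have "drive (count_list (take (length (w @ u)) (w @ u))) \<tau> = drive (count_list u) (drive (count_list w) \<tau>)"
      unfolding drive_drive by (intro drive_cong) simp
    also have "\<dots> = \<sigma>" using g u(2) drive_cong by metis
    finally have "\<exists>j\<le>length (w @ u). drive (count_list (take j (w @ u))) \<tau> = \<sigma>" by blast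
    moreover have "\<exists>j\<le>length (w @ u). drive (count_list (take j (w @ u))) \<rho> = \<sigma>" if "\<rho> \<in> F" for \<rho>
      using w(2)[OF that]
    proof (elim exE conjE)
      fix j assume "j \<le> length w" "drive (count_list (take j w)) \<rho> = \<sigma>"
      then show ?thesis by (intro exI[of _ j]) simp
    qed
    ultimately have "\<forall>\<rho>\<in>insert \<tau> F. \<exists>j\<le>length (w @ u). drive (count_list (take j (w @ u))) \<rho> = \<sigma>"
      by (intro ballI) (elim insertE, simp_all only:)
    moreover have "set (w @ u) \<subseteq> W" using w(1) u(1) by simp
    ultimately show ?case by (intro exI[of _ "w @ u"] conjI)
  qed (auto intro: exI[of _ "[]"])
  from this[OF \<open>finite R\<close> order_refl] obtain w where w: "set w \<subseteq> W"
    "\<And>\<tau>. \<tau> \<in> R \<Longrightarrow> \<exists>j\<le>length w. drive (count_list (take j w)) \<tau> = \<sigma>" by blast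
  obtain v0 where v0: "v0 \<in> W" using ne by blast
  \<comment> \<open>The extra first letter \<open>v0\<close> makes the time of return positive.\<close>
  have return: "\<exists>k>0. sandpile_chain adj W \<sigma> Y k = \<sigma>"
    if hit: "\<exists>k. \<forall>i<length (v0 # w). Y (k + i) = (v0 # w) ! i" for Y
  proof -
    obtain k where k: "\<And>i. i < length (v0 # w) \<Longrightarrow> Y (k + i) = (v0 # w) ! i" using hit by blast
    have Y: "Y (Suc k + i) = w ! i" if "i < length w" for i using k[of "Suc i"] that by simp
    have count: "(\<Sum>i<j. unit_mass (Y (Suc k + i)) v) = count_list (take j w) v" if "j \<le> length w" for j v
      using that
    proof (induction j)
      case (Suc j)
      then show ?case using Y[of j]
        by (simp add: take_Suc_conv_app_nth unit_mass_def)
    qed simp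
    have "sandpile_chain adj W \<sigma> Y (Suc k) \<in> R"
      unfolding sandpile_chain_eq[OF stable] R_def by blast
    then obtain j where j: "j \<le> length w"
      "drive (count_list (take j w)) (sandpile_chain adj W \<sigma> Y (Suc k)) = \<sigma>" using w(2) by blast
    have split: "(\<Sum>i<m + j. f i) = (\<Sum>i<m. f i) + (\<Sum>i<j. f (m + i))" for f :: "nat \<Rightarrow> nat" and m j
      by (induction j) simp_all
    have "sandpile_chain adj W \<sigma> Y (Suc k + j) =
        drive (\<lambda>v. (\<Sum>i<Suc k. unit_mass (Y i) v) + (\<Sum>i<j. unit_mass (Y (Suc k + i)) v)) \<sigma>"
      unfolding sandpile_chain_eq[OF stable] split ..
    also have "\<dots> = drive (count_list (take j w)) (sandpile_chain adj W \<sigma> Y (Suc k))"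
      unfolding sandpile_chain_eq[OF stable] drive_drive count[OF j(1)] ..
    finally show ?thesis using j(2) by (intro exI[of _ "Suc k + j"]) simp
  qed
  have "AE Y in Pi\<^sub>M (UNIV :: nat set) (\<lambda>_. measure_pmf (pmf_of_set W)).
      \<exists>k. \<forall>i<length (v0 # w). Y (k + i) = (v0 # w) ! i"
    using w(1) v0 ne finite_W by (intro AE_iid_contains_word) auto
  then have "AE Y in Pi\<^sub>M (UNIV :: nat set) (\<lambda>_. measure_pmf (pmf_of_set W)).
      \<exists>k>0. sandpile_chain adj W \<sigma> Y k = \<sigma>"
    by (rule eventually_mono) (rule return)
  then show ?thesis using stable by (simp add: recurrent_sandpiles_def)
qed

lemma recurrent_iff:
  assumes "W \<noteq> {}"
  shows "\<sigma> \<in> recurrent_sandpiles adj W \<longleftrightarrow>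
    \<sigma> \<in> stable_sandpiles adj W \<and> (\<exists>G. (\<forall>v\<in>W. 0 < G v) \<and> drive G \<sigma> = \<sigma>)"
  using recurrent_imp_drive_fixed[OF assms] drive_fixed_imp_recurrent[OF assms]
  by (auto simp: recurrent_sandpiles_def)

lemma finite_recurrent: "finite (recurrent_sandpiles adj W)"
  by (rule finite_subset[OF _ finite_stable]) (auto simp: recurrent_sandpiles_def)

lemma recurrent_stable: "\<sigma> \<in> recurrent_sandpiles adj W \<Longrightarrow> \<sigma> \<in> stable_sandpiles adj W"
  by (simp add: recurrent_sandpiles_def)

text \<open>Among the stabilizations of the constant configurations two coincide, which gives a loop.\<close>

lemma recurrent_nonempty:
  assumes "W \<noteq> {}"
  shows "recurrent_sandpiles adj W \<noteq> {}"
proof -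
  define c where "c k = drive (\<lambda>v. k) (\<lambda>v. 0)" for k :: nat
  have "range c \<subseteq> stable_sandpiles adj W" by (auto simp: c_def)
  then have "finite (range c)" by (rule finite_subset[OF _ finite_stable])
  then have "\<not> inj c" using finite_imageD[of c UNIV] by auto
  then obtain i j where ij: "i < j" "c i = c j"
    unfolding inj_def by (metis linorder_neqE_nat)
  have "drive (\<lambda>v. j - i) (c i) = c i"
    using ij unfolding c_def drive_drive by simp
  then have "c i \<in> recurrent_sandpiles adj W"
    unfolding recurrent_iff[OF assms] using ij
    by (intro conjI exI[of _ "\<lambda>v. j - i"]) (auto simp: c_def)
  then show ?thesis by blast
qed

lemma drive_recurrent:
  assumes "W \<noteq> {}" "\<sigma> \<in> recurrent_sandpiles adj W"
  shows "drive g \<sigma> \<in> recurrent_sandpiles adj W"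
proof -
  obtain G where G: "\<forall>v\<in>W. 0 < G v" "drive G \<sigma> = \<sigma>"
    using assms recurrent_iff by blast
  have "drive G (drive g \<sigma>) = drive g (drive G \<sigma>)" by (simp add: drive_drive add.commute)
  then show ?thesis using G assms(1) by (auto simp: recurrent_iff)
qed

lemma drive_recurrent_surj:
  assumes "W \<noteq> {}" "\<sigma> \<in> recurrent_sandpiles adj W"
  shows "\<exists>\<zeta>\<in>recurrent_sandpiles adj W. drive g \<zeta> = \<sigma>"
proof -
  obtain G where G: "\<And>v. v \<in> W \<Longrightarrow> 0 < G v" "drive G \<sigma> = \<sigma>"
    using assms recurrent_iff by blast
  obtain n where "drive (\<lambda>v. n * G v - g v) (drive g \<sigma>) = \<sigma>"
    using drive_fixed_returns[OF recurrent_stable[OF assms(2)] G(2,1), of g] by blast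
  then have "drive g (drive (\<lambda>v. n * G v - g v) \<sigma>) = \<sigma>" by (simp add: drive_drive add.commute)
  then show ?thesis using drive_recurrent[OF assms] by blast
qed

lemma bij_betw_drive:
  assumes "W \<noteq> {}"
  shows "bij_betw (drive g) (recurrent_sandpiles adj W) (recurrent_sandpiles adj W)"
proof -
  have "drive g ` recurrent_sandpiles adj W = recurrent_sandpiles adj W"
    using drive_recurrent[OF assms] drive_recurrent_surj[OF assms] by (auto simp: image_iff) metis
  then show ?thesis using finite_recurrent
    by (auto simp: bij_betw_def intro: eq_card_imp_inj_on)
qed

lemma lap_diff:
  assumes "v \<in> W"
  shows "lap adj W (\<lambda>u. f u - g u) v = lap adj W f v - lap adj W g v"
  using assms by (simp add: lap_eq finite_W sum_subtractf algebra_simps)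

lemma lap_add:
  assumes "v \<in> W"
  shows "lap adj W (\<lambda>u. f u + g u) v = lap adj W f v + lap adj W g v"
  using assms by (simp add: lap_eq finite_W sum.distrib algebra_simps)

lemma lap_mult:
  assumes "v \<in> W"
  shows "lap adj W (\<lambda>u. c * f u) v = c * lap adj W f v"
  using assms by (simp add: lap_eq finite_W sum_distrib_left algebra_simps)

text \<open>Write \<open>\<sigma>\<close> as \<open>drive E \<zeta>\<close> with \<open>\<zeta>\<close> recurrent, where \<open>E\<close> holds enough grains to fire both the positive
  part \<open>fp\<close> and the negative part \<open>fm\<close> of \<open>f\<close>. Firing \<open>fp\<close> after the addition of \<open>g\<close> and firing \<open>fm\<close>
  after the addition of \<open>h\<close> lead to the same configuration \<open>\<rho>\<close>.\<close>

lemma drive_eq_if_equivalent: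
  assumes "W \<noteq> {}" "\<sigma> \<in> recurrent_sandpiles adj W"
    and f: "\<And>v. v \<in> W \<Longrightarrow> int (g v) - int (h v) = lap adj W f v"
  shows "drive g \<sigma> = drive h \<sigma>"
proof -
  define fp fm where "fp v = nat (f v)" and "fm v = nat (- f v)" for v
  define E where "E v = deg v * fp v + deg v * fm v" for v
  have E_ge: "deg v * fp v \<le> E v" "deg v * fm v \<le> E v" for v by (simp_all add: E_def)
  obtain \<zeta> where \<zeta>: "drive E \<zeta> = \<sigma>" using drive_recurrent_surj[OF assms(1,2)] by blast
  define \<rho> where "\<rho> = (\<lambda>v\<in>W. nat (int (\<zeta> v + (E v + g v)) - lap adj W (\<lambda>v. int (fp v)) v))"
  have \<rho>: "\<rho> \<in> sandpiles W" by (simp add: \<rho>_def sandpiles_def)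
  have \<rho>_fp: "int (\<rho> v) = int (\<zeta> v + (E v + g v)) - lap adj W (\<lambda>v. int (fp v)) v" if "v \<in> W" for v
  proof -
    have "lap adj W (\<lambda>v. int (fp v)) v \<le> int (deg v) * int (fp v)"
      using that by (simp add: lap_eq finite_W sum_nonneg)
    also have "\<dots> \<le> int (\<zeta> v + (E v + g v))" by (simp add: E_def)
    finally show ?thesis using that by (simp add: \<rho>_def)
  qed
  have f_eq: "f = (\<lambda>v. int (fp v) - int (fm v))" by (auto simp: fp_def fm_def)
  have \<rho>_fm: "int (\<rho> v) = int (\<zeta> v + (E v + h v)) - lap adj W (\<lambda>v. int (fm v)) v" if "v \<in> W" for v
    using \<rho>_fp[OF that] f[OF that] that unfolding f_eq by (simp add: lap_diff)
  have "(legal_topple adj W)\<^sup>*\<^sup>* (add_grains \<zeta> (\<lambda>v. E v + g v)) \<rho>"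
    by (rule legal_firing[where f = fp])
      (simp_all add: \<rho>[unfolded sandpiles_def] \<rho>_fp sandpiles_def add_grains_def trans_le_add2 trans_le_add1 E_ge)
  moreover have "(legal_topple adj W)\<^sup>*\<^sup>* (add_grains \<zeta> (\<lambda>v. E v + h v)) \<rho>"
    by (rule legal_firing[where f = fm])
      (simp_all add: \<rho>[unfolded sandpiles_def] \<rho>_fm sandpiles_def add_grains_def trans_le_add2 trans_le_add1 E_ge)
  ultimately have "drive (\<lambda>v. E v + g v) \<zeta> = drive (\<lambda>v. E v + h v) \<zeta>"
    unfolding drive_def using stabilization_legal_topples[OF add_grains_sandpiles] by simp
  then show ?thesis unfolding \<zeta>[symmetric] drive_drive .
qed

section \<open>Orders in the sandpile group\<close>

lemma lap_cong: "(\<And>v. v \<in> W \<Longrightarrow> f v = g v) \<Longrightarrow> lap adj W f = lap adj W g"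
  by (simp add: lap_def cong: sum.cong restrict_cong)

lemma mem_lap_image:
  "x \<in> lap_image adj W \<longleftrightarrow> x \<in> extensional W \<and> (\<exists>f. \<forall>v\<in>W. x v = lap adj W f v)"
proof
  assume "x \<in> lap_image adj W"
  then show "x \<in> extensional W \<and> (\<exists>f. \<forall>v\<in>W. x v = lap adj W f v)"
    by (auto simp: lap_image_def lap_def)
next
  assume x: "x \<in> extensional W \<and> (\<exists>f. \<forall>v\<in>W. x v = lap adj W f v)"
  then obtain f where f: "\<And>v. v \<in> W \<Longrightarrow> x v = lap adj W f v" by blast
  have "x = lap adj W f"
    by (rule extensionalityI[where A = W]) (use x f in \<open>auto simp: lap_def\<close>)
  also have "\<dots> = lap adj W (restrict f W)" by (rule lap_cong) simp
  finally show "x \<in> lap_image adj W" by (auto simp: lap_image_def)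
qed

lemma comm_group_int_functions: "comm_group (int_functions W)"
proof -
  have "group (int_functions W)" by (rule product_group) simp
  then show ?thesis
    by (rule group.group_comm_groupI) (auto simp: add.commute)
qed

lemma normal_lap_image: "lap_image adj W \<lhd> int_functions W"
proof -
  interpret Z: comm_group "int_functions W" by (rule comm_group_int_functions)
  have "subgroup (lap_image adj W) (int_functions W)"
  proof (rule Z.subgroupI)
    show "lap_image adj W \<subseteq> carrier (int_functions W)"
      by (auto simp: mem_lap_image PiE_iff extensional_def)
    have "(\<lambda>v\<in>W. 0) \<in> lap_image adj W"
      unfolding mem_lap_image by (auto intro!: exI[of _ "\<lambda>v. 0"] simp: lap_eq finite_W)
    then show "lap_image adj W \<noteq> {}" by blast
  next
    fix a assume a: "a \<in> lap_image adj W"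
    then obtain f where f: "\<And>v. v \<in> W \<Longrightarrow> a v = lap adj W f v" by (auto simp: mem_lap_image)
    have "inv\<^bsub>int_functions W\<^esub> a = (\<lambda>v\<in>W. - a v)"
      using a by (subst inv_product_group) (auto simp: mem_lap_image PiE_iff)
    moreover have "(\<lambda>v\<in>W. - a v) \<in> lap_image adj W"
      unfolding mem_lap_image
      by (auto intro!: exI[of _ "\<lambda>v. (- 1) * f v"] simp only: lap_mult f) (simp_all add: f)
    ultimately show "inv\<^bsub>int_functions W\<^esub> a \<in> lap_image adj W" by simp
  next
    fix a b assume a: "a \<in> lap_image adj W" and b: "b \<in> lap_image adj W"
    then obtain f g where "\<And>v. v \<in> W \<Longrightarrow> a v = lap adj W f v" "\<And>v. v \<in> W \<Longrightarrow> b v = lap adj W g v"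
      by (auto simp: mem_lap_image)
    then have "\<forall>v\<in>W. a v + b v = lap adj W (\<lambda>v. f v + g v) v" by (simp add: lap_add)
    then show "a \<otimes>\<^bsub>int_functions W\<^esub> b \<in> lap_image adj W"
      unfolding mem_lap_image by auto
  qed
  then show ?thesis by (simp add: Z.normal_iff_subgroup)
qed

lemma group_sandpile_group: "group (sandpile_group adj W)"
  unfolding sandpile_group_def using normal_lap_image by (rule normal.factorgroup_is_group)

lemma sandpile_class_carrier: "sandpile_class adj W \<eta> \<in> carrier (sandpile_group adj W)"
  unfolding sandpile_class_def sandpile_group_def FactGroup_def RCOSETS_def by auto

lemma sandpile_class_pow:
  "sandpile_class adj W \<eta> [^]\<^bsub>sandpile_group adj W\<^esub> n =
    lap_image adj W #>\<^bsub>int_functions W\<^esub> (\<lambda>v\<in>W. int n * int (\<eta> v))"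
proof -
  interpret Q: group "sandpile_group adj W" by (rule group_sandpile_group)
  interpret N: normal "lap_image adj W" "int_functions W" by (rule normal_lap_image)
  show ?thesis
  proof (induction n)
    case 0
    have "(\<lambda>v\<in>W. 0) \<in> lap_image adj W" using subgroup.one_closed[OF N.subgroup_axioms] by simp
    then have "lap_image adj W #>\<^bsub>int_functions W\<^esub> (\<lambda>v\<in>W. 0) = lap_image adj W"
      by (intro N.coset_join2[OF _ N.subgroup_axioms]) auto
    then show ?case by (simp add: sandpile_group_def restrict_def)
  next
    case (Suc n)
    have "sandpile_class adj W \<eta> [^]\<^bsub>sandpile_group adj W\<^esub> Suc n =
        (lap_image adj W #>\<^bsub>int_functions W\<^esub> (\<lambda>v\<in>W. int n * int (\<eta> v)))
        <#>\<^bsub>int_functions W\<^esub> (lap_image adj W #>\<^bsub>int_functions W\<^esub> (\<lambda>v\<in>W. int (\<eta> v)))"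
      unfolding Q.nat_pow_Suc Suc by (simp add: sandpile_group_def sandpile_class_def)
    also have "\<dots> = lap_image adj W #>\<^bsub>int_functions W\<^esub>
        ((\<lambda>v\<in>W. int n * int (\<eta> v)) \<otimes>\<^bsub>int_functions W\<^esub> (\<lambda>v\<in>W. int (\<eta> v)))"
      by (rule N.rcos_sum) auto
    also have "(\<lambda>v\<in>W. int n * int (\<eta> v)) \<otimes>\<^bsub>int_functions W\<^esub> (\<lambda>v\<in>W. int (\<eta> v)) =
        (\<lambda>v\<in>W. int (Suc n) * int (\<eta> v))"
      by (auto simp: algebra_simps)
    finally show ?case .
  qed
qed

lemma sandpile_class_pow_eq_one_iff:
  "sandpile_class adj W \<eta> [^]\<^bsub>sandpile_group adj W\<^esub> n = \<one>\<^bsub>sandpile_group adj W\<^esub> \<longleftrightarrow>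
    (\<exists>f. \<forall>v\<in>W. int n * int (\<eta> v) = lap adj W f v)"
proof -
  interpret N: normal "lap_image adj W" "int_functions W" by (rule normal_lap_image)
  have "lap_image adj W #>\<^bsub>int_functions W\<^esub> x = lap_image adj W \<longleftrightarrow> x \<in> lap_image adj W"
    if "x \<in> carrier (int_functions W)" for x
    using that N.coset_join1[OF _ that N.subgroup_axioms] N.coset_join2[OF that N.subgroup_axioms] by blast
  from this[of "\<lambda>v\<in>W. int n * int (\<eta> v)"] show ?thesis
    unfolding sandpile_class_pow by (auto simp: sandpile_group_def mem_lap_image)
qed

text \<open>The order function is 0 on elements of infinite order, so finiteness of the order has to be shown
  before a bound on it says anything. Each multiple of \<open>\<eta>\<close> is equivalent to a stable sandpile (up to
  adding \<open>\<eta>\<close> itself), and there are only finitely many of those.\<close>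

lemma ord_sandpile_class_pos: "0 < group.ord (sandpile_group adj W) (sandpile_class adj W \<eta>)"
proof -
  interpret Q: group "sandpile_group adj W" by (rule group_sandpile_group)
  define c where "c k = drive (\<lambda>v. k * \<eta> v) \<eta>" for k :: nat
  have "range c \<subseteq> stable_sandpiles adj W" by (auto simp: c_def)
  then have "finite (range c)" by (rule finite_subset[OF _ finite_stable])
  then have "\<not> inj c" using finite_imageD[of c UNIV] by auto
  then obtain i j where ij: "i < j" "c i = c j"
    unfolding inj_def by (metis linorder_neqE_nat)
  have c: "\<exists>f. \<forall>v\<in>W. int (c k v) = int (\<eta> v) + int k * int (\<eta> v) - lap adj W f v" for k
    unfolding c_def using drive_sequence[of \<eta> "\<lambda>v. k * \<eta> v"] by (metis of_nat_mult)
  obtain f g where fg: "\<And>v. v \<in> W \<Longrightarrow> int (c i v) = int (\<eta> v) + int i * int (\<eta> v) - lap adj W f v"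
    "\<And>v. v \<in> W \<Longrightarrow> int (c j v) = int (\<eta> v) + int j * int (\<eta> v) - lap adj W g v"
    using c[of i] c[of j] by blast
  have "int (j - i) * int (\<eta> v) = lap adj W (\<lambda>u. g u - f u) v" if "v \<in> W" for v
    using fg[OF that] ij that by (simp add: lap_diff of_nat_diff algebra_simps)
  then have "sandpile_class adj W \<eta> [^]\<^bsub>sandpile_group adj W\<^esub> (j - i) = \<one>\<^bsub>sandpile_group adj W\<^esub>"
    unfolding sandpile_class_pow_eq_one_iff by blast
  then have "Q.ord (sandpile_class adj W \<eta>) dvd j - i"
    using Q.pow_eq_id[OF sandpile_class_carrier] by blast
  then show ?thesis using ij by (intro Nat.gr0I) auto
qed

lemma multiple_of_sandpile_in_lap_image:
  assumes "group.ord (sandpile_group adj W) (sandpile_class adj W \<eta>) < M"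
  shows "\<exists>f. \<forall>v\<in>W. int (fact M) * int (\<eta> v) = lap adj W f v"
proof -
  interpret Q: group "sandpile_group adj W" by (rule group_sandpile_group)
  have "Q.ord (sandpile_class adj W \<eta>) dvd fact M"
    using assms ord_sandpile_class_pos[of \<eta>] by (intro dvd_fact) auto
  then show ?thesis
    using Q.pow_eq_id[OF sandpile_class_carrier] sandpile_class_pow_eq_one_iff by blast
qed

text \<open>Only classes of recurrent sandpiles have a bounded order by assumption, but the class of \<open>\<delta>\<^sub>x\<close> is
  the difference of the classes of \<open>drive (unit_mass x) \<eta>\<close> and \<open>\<eta>\<close>.\<close>

lemma multiple_of_unit_mass_in_lap_image:
  assumes ne: "W \<noteq> {}"
    and ord: "\<And>\<eta>. \<eta> \<in> recurrent_sandpiles adj W \<Longrightarrow>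
      group.ord (sandpile_group adj W) (sandpile_class adj W \<eta>) < M"
  shows "\<exists>f. \<forall>v\<in>W. int (fact M * unit_mass x v) = lap adj W f v"
proof -
  obtain \<eta> where \<eta>: "\<eta> \<in> recurrent_sandpiles adj W" using recurrent_nonempty[OF ne] by blast
  obtain f where f: "\<And>v. v \<in> W \<Longrightarrow> int (fact M) * int (\<eta> v) = lap adj W f v"
    using multiple_of_sandpile_in_lap_image[OF ord[OF \<eta>]] by blast
  obtain g where g: "\<And>v. v \<in> W \<Longrightarrow> int (fact M) * int (drive (unit_mass x) \<eta> v) = lap adj W g v"
    using multiple_of_sandpile_in_lap_image[OF ord[OF drive_recurrent[OF ne \<eta>]]] by blast
  obtain vs where "\<And>v. v \<in> W \<Longrightarrow> int (drive (unit_mass x) \<eta> v) =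
      int (\<eta> v) + int (unit_mass x v) - lap adj W (\<lambda>v. int (count_list vs v)) v"
    using drive_sequence[of \<eta> "unit_mass x"] by metis
  note drive_eq = this
  have "int (fact M * unit_mass x v) = lap adj W (\<lambda>u. g u - f u + int (fact M) * int (count_list vs u)) v"
    if "v \<in> W" for v
    using that unfolding lap_add[OF that] lap_diff[OF that] lap_mult[OF that]
      f[OF that, symmetric] g[OF that, symmetric] drive_eq[OF that]
    by (simp add: algebra_simps)
  then show ?thesis by blast
qed

section \<open>Toppling probabilities in a finite domain\<close>

definition topples_within :: "'v \<Rightarrow> 'v \<Rightarrow> ('v \<Rightarrow> nat) \<Rightarrow> bool" where
  "topples_within x y \<eta> \<longleftrightarrow>
    (\<exists>vs. set vs \<subseteq> W \<and> legal_sequence adj (\<lambda>v. \<eta> v + unit_mass x v) vs \<and> y \<in> set vs)"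

text \<open>Minimum principle: at a zero of \<open>u \<ge> 0\<close> the Laplacian is minus the sum of the values at the
  neighbours. This excludes a zero at \<open>x\<close>, and a zero next to a vertex where \<open>u\<close> is positive.\<close>

lemma lap_multiple_of_unit_mass_pos:
  fixes u :: "'v \<Rightarrow> nat"
  assumes "0 < L" "\<And>v. v \<in> W \<Longrightarrow> lap adj W (\<lambda>w. int (u w)) v = int (L * unit_mass x v)"
    and "x \<in> W" "(\<lambda>a b. adj a b \<and> a \<in> W \<and> b \<in> W)\<^sup>*\<^sup>* x y"
  shows "0 < u y"
  using assms(4)
proof (induction rule: rtranclp_induct)
  case base
  show ?case
  proof (rule ccontr)
    assume "\<not> 0 < u x"
    then have "lap adj W (\<lambda>w. int (u w)) x \<le> 0"
      using \<open>x \<in> W\<close> by (simp add: lap_eq finite_W sum_nonneg)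
    then show False using assms(1) assms(2)[OF \<open>x \<in> W\<close>] by (simp add: unit_mass_def)
  qed
next
  case (step y z)
  show ?case
  proof (rule ccontr)
    assume "\<not> 0 < u z"
    then have "lap adj W (\<lambda>w. int (u w)) z = - (\<Sum>w | adj z w \<and> w \<in> W. int (u w))"
      using step by (simp add: lap_eq finite_W)
    moreover have "int (u y) \<le> (\<Sum>w | adj z w \<and> w \<in> W. int (u w))"
      using step adj_sym finite_W by (intro member_le_sum) auto
    moreover have "0 \<le> lap adj W (\<lambda>w. int (u w)) z" using step assms(2)[of z] by simp
    ultimately show False using step by linarith
  qed
qed

text \<open>The \<open>L\<close> additions lead from \<open>\<eta>\<close> back to \<open>\<eta>\<close>, so the Laplacian of the total number of topplings
  is \<open>L\<close> times the unit mass.\<close>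

lemma topples_within_some_addition:
  assumes ne: "W \<noteq> {}" and L: "0 < L" "\<And>v. v \<in> W \<Longrightarrow> int (L * unit_mass x v) = lap adj W f v"
    and \<eta>: "\<eta> \<in> recurrent_sandpiles adj W"
    and xy: "x \<in> W" "(\<lambda>a b. adj a b \<and> a \<in> W \<and> b \<in> W)\<^sup>*\<^sup>* x y"
  shows "\<exists>k<L. topples_within x y (drive (\<lambda>v. k * unit_mass x v) \<eta>)"
proof -
  define s where "s k = drive (\<lambda>v. k * unit_mass x v) \<eta>" for k
  have s0: "s 0 = \<eta>" unfolding s_def by (simp add: drive_0 recurrent_stable \<eta>)
  have s_Suc: "s (Suc k) = drive (unit_mass x) (s k)" for k
    unfolding s_def drive_drive by (simp add: add.commute)
  have "s L = drive (\<lambda>v. 0) \<eta>"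
    unfolding s_def using L(2) by (intro drive_eq_if_equivalent[OF ne \<eta>, where f = f]) simp
  then have sL: "s L = \<eta>" by (simp add: drive_0 recurrent_stable \<eta>)
  have "\<exists>vs. set vs \<subseteq> W \<and> legal_sequence adj (add_grains (s k) (unit_mass x)) vs \<and>
      (\<forall>u\<in>W. int (s (Suc k) u) = int (s k u) + int (unit_mass x u)
        - lap adj W (\<lambda>v. int (count_list vs v)) u)" for k
    unfolding s_Suc by (rule drive_sequence[of "s k" "unit_mass x"]) blast
  then obtain vs where vs: "\<And>k. set (vs k) \<subseteq> W"
    "\<And>k. legal_sequence adj (add_grains (s k) (unit_mass x)) (vs k)"
    "\<And>k u. u \<in> W \<Longrightarrow> int (s (Suc k) u) = int (s k u) + int (unit_mass x u)
        - lap adj W (\<lambda>v. int (count_list (vs k) v)) u"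
    by metis
  have sum: "int (s n u) = int (\<eta> u) + int (n * unit_mass x u)
      - lap adj W (\<lambda>v. int (\<Sum>k<n. count_list (vs k) v)) u" if "u \<in> W" for n u
  proof (induction n)
    case 0
    then show ?case using that by (simp add: s0 lap_eq finite_W)
  next
    case (Suc n)
    then show ?case using vs(3)[OF that, of n] that by (simp add: lap_add algebra_simps)
  qed
  have "0 < (\<Sum>k<L. count_list (vs k) y)"
  proof (rule lap_multiple_of_unit_mass_pos[OF L(1) _ xy])
    fix v assume "v \<in> W"
    from sum[OF this, of L] show
      "lap adj W (\<lambda>w. int (\<Sum>k<L. count_list (vs k) w)) v = int (L * unit_mass x v)"
      unfolding sL by simp
  qed
  then obtain k where k: "k < L" "count_list (vs k) y \<noteq> 0"
    by (metis (no_types, lifting) lessThan_iff less_irrefl sum.neutral)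
  have "legal_sequence adj (\<lambda>v. s k v + unit_mass x v) (vs k)"
    using vs(2)[of k] legal_sequence_agree[OF vs(1)[of k],
        of "add_grains (s k) (unit_mass x)" "\<lambda>v. s k v + unit_mass x v" adj]
    by (simp add: add_grains_def)
  moreover have "y \<in> set (vs k)" using k(2) by (metis count_list_0_iff)
  ultimately have "topples_within x y (s k)" using vs(1) unfolding topples_within_def by blast
  then show ?thesis using k(1) unfolding s_def by blast
qed

text \<open>The sets \<open>A k\<close> of those \<open>\<eta>\<close> for which \<open>y\<close> topples in the addition number \<open>k\<close> cover the recurrent
  sandpiles, and all have the same size because additions are permutations.\<close>

lemma prob_topples_within:
  assumes ne: "W \<noteq> {}"
    and ord: "\<And>\<eta>. \<eta> \<in> recurrent_sandpiles adj W \<Longrightarrow>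
      group.ord (sandpile_group adj W) (sandpile_class adj W \<eta>) < M"
    and xy: "x \<in> W" "(\<lambda>a b. adj a b \<and> a \<in> W \<and> b \<in> W)\<^sup>*\<^sup>* x y"
  shows "1 / fact M \<le> measure_pmf.prob (pmf_of_set (recurrent_sandpiles adj W)) {\<eta>. topples_within x y \<eta>}"
proof -
  let ?R = "recurrent_sandpiles adj W"
  define L :: nat where "L = fact M"
  have L: "0 < L" by (simp add: L_def)
  obtain f where f: "\<And>v. v \<in> W \<Longrightarrow> int (L * unit_mass x v) = lap adj W f v"
    using multiple_of_unit_mass_in_lap_image[OF ne ord, of x] unfolding L_def by blast
  define A where "A k = {\<eta> \<in> ?R. topples_within x y (drive (\<lambda>v. k * unit_mass x v) \<eta>)}" for k
  define T where "T = {\<eta> \<in> ?R. topples_within x y \<eta>}"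
  have "card (A k) = card T" for k
  proof -
    have bij: "bij_betw (drive (\<lambda>v. k * unit_mass x v)) ?R ?R" by (rule bij_betw_drive[OF ne])
    have "drive (\<lambda>v. k * unit_mass x v) ` A k = T"
      using bij unfolding A_def T_def bij_betw_def by (auto simp: image_iff)
    moreover have "inj_on (drive (\<lambda>v. k * unit_mass x v)) (A k)"
      using bij unfolding bij_betw_def A_def by (auto intro: inj_on_subset)
    ultimately show ?thesis using card_image by metis
  qed
  moreover have "?R \<subseteq> (\<Union>k<L. A k)"
    using topples_within_some_addition[OF ne L f _ xy] unfolding A_def by blast
  then have "card ?R \<le> card (\<Union>k<L. A k)"
    using finite_recurrent by (intro card_mono) (auto simp: A_def)
  moreover have "card (\<Union>k<L. A k) \<le> (\<Sum>k<L. card (A k))" by (rule card_UN_le) simp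
  ultimately have "card ?R \<le> L * card T" by simp
  then have "real (card ?R) \<le> real L * real (card T)" by (metis of_nat_le_iff of_nat_mult)
  moreover have "0 < card ?R" using finite_recurrent recurrent_nonempty[OF ne] by (simp add: card_gt_0_iff)
  ultimately have "1 / real L \<le> real (card T) / real (card ?R)"
    using L by (simp add: field_simps)
  also have "\<dots> = measure_pmf.prob (pmf_of_set ?R) {\<eta>. topples_within x y \<eta>}"
    using finite_recurrent recurrent_nonempty[OF ne]
    by (subst measure_pmf_of_set) (auto simp: T_def Int_def)
  finally show ?thesis by (simp add: L_def)
qed

end

section \<open>Avalanches that leave a ball\<close>

lemma less_graph_diam_iff:
  "r < graph_diam adj A \<longleftrightarrow> (\<exists>v\<in>A. \<exists>w\<in>A. r < graph_dist adj v w)"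
  by (simp add: graph_diam_def less_SUP_iff)

lemma graph_dist_self: "graph_dist adj x x = 0"
proof -
  have "graph_dist adj x x \<le> enat 0"
    unfolding graph_dist_def by (rule Inf_lower) (auto intro!: exI[of _ 0])
  then show ?thesis by (simp flip: zero_enat_def)
qed

lemma graph_dist_leD:
  assumes "graph_dist adj x v \<le> enat r"
  shows "\<exists>k\<le>r. (adj ^^ k) x v"
proof -
  let ?S = "{enat k | k. (adj ^^ k) x v}"
  have "?S \<noteq> {}"
  proof
    assume "?S = {}"
    then have "graph_dist adj x v = \<infinity>" by (simp only: graph_dist_def Inf_enat_def if_True simp_thms)
    then show False using assms by simp
  qed
  then obtain a where "a \<in> ?S" by blast
  then have "(LEAST a. a \<in> ?S) \<in> ?S" by (rule LeastI)
  moreover have "graph_dist adj x v = (LEAST a. a \<in> ?S)"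
    using \<open>?S \<noteq> {}\<close> by (simp only: graph_dist_def Inf_enat_def if_False)
  ultimately show ?thesis using assms by auto
qed

lemma ereal_less_ereal_of_enat_iff:
  assumes "0 \<le> R"
  shows "ereal R < ereal_of_enat d \<longleftrightarrow> enat (nat \<lfloor>R\<rfloor>) < d"
proof (cases d)
  case (enat n)
  have "R < real n \<longleftrightarrow> nat \<lfloor>R\<rfloor> < n" using assms by linarith
  then show ?thesis using enat by simp
qed simp

lemma sets_legal_sequence:
  assumes "\<And>u. (\<lambda>\<eta>. f \<eta> u) \<in> N \<rightarrow>\<^sub>M count_space UNIV"
  shows "{\<eta> \<in> space N. legal_sequence adj (f \<eta>) vs} \<in> sets N"
  using assms
proof (induction vs arbitrary: f)
  case (Cons v vs)
  have [measurable]: "(\<lambda>\<eta>. f \<eta> u) \<in> N \<rightarrow>\<^sub>M count_space UNIV" for u by (rule Cons.prems)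
  have "(\<lambda>\<eta>. topple adj v (f \<eta>) u) \<in> N \<rightarrow>\<^sub>M count_space UNIV" for u
    unfolding topple_def by measurable
  from Cons.IH[OF this] have "{\<eta> \<in> space N. legal_sequence adj (topple adj v (f \<eta>)) vs} \<in> sets N" .
  moreover have "{\<eta> \<in> space N. card {y. adj v y} \<le> f \<eta> v} \<in> sets N" by measurable
  ultimately show ?case by (simp add: sets.sets_Collect_conj)
qed simp

context locally_finite_graph
begin

lemma finite_ball: "finite {v. graph_dist adj x v \<le> enat r}"
proof (rule finite_subset)
  have "finite {v. (adj ^^ k) x v}" for k
  proof (induction k)
    case (Suc k)
    have "{v. (adj ^^ Suc k) x v} = (\<Union>u\<in>{u. (adj ^^ k) x u}. {v. adj u v})" by auto
    then show ?case using Suc finite_nbrs by simp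
  qed simp
  then show "finite (\<Union>k\<le>r. {v. (adj ^^ k) x v})" by blast
  show "{v. graph_dist adj x v \<le> enat r} \<subseteq> (\<Union>k\<le>r. {v. (adj ^^ k) x v})"
    using graph_dist_leD by fastforce
qed

definition closed_neighbourhood :: "'v set \<Rightarrow> 'v set" where
  "closed_neighbourhood K = K \<union> (\<Union>v\<in>K. {u. adj v u})"

text \<open>A local substitute for the event that a vertex outside \<open>K\<close> topples: all topplings but the last one
  take place in \<open>K\<close>, so only the heights on the closed neighbourhood of \<open>K\<close> matter.\<close>

definition escapes :: "'v set \<Rightarrow> 'v \<Rightarrow> ('v \<Rightarrow> nat) \<Rightarrow> bool" where
  "escapes K x \<eta> \<longleftrightarrow> (\<exists>us w. set us \<subseteq> K \<and> w \<in> closed_neighbourhood K - K \<and>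
     legal_sequence adj (\<lambda>v. \<eta> v + unit_mass x v) (us @ [w]))"

lemma escapes_cong:
  assumes "\<And>v. v \<in> closed_neighbourhood K \<Longrightarrow> \<eta> v = \<xi> v"
  shows "escapes K x \<eta> \<longleftrightarrow> escapes K x \<xi>"
proof -
  have "legal_sequence adj (\<lambda>v. \<eta> v + unit_mass x v) (us @ [w]) \<longleftrightarrow>
      legal_sequence adj (\<lambda>v. \<xi> v + unit_mass x v) (us @ [w])"
    if "set us \<subseteq> K" "w \<in> closed_neighbourhood K - K" for us w
    by (rule legal_sequence_agree[where A = "closed_neighbourhood K"])
      (use that assms in \<open>auto simp: closed_neighbourhood_def\<close>)
  then show ?thesis unfolding escapes_def by blast
qed

text \<open>The first vertex \<open>w\<close> outside \<open>K\<close> to topple was stable at the beginning, so it received a grain from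
  a vertex that toppled before and hence lies in \<open>K\<close>.\<close>

lemma escapes_if_topples_outside:
  assumes "legal_sequence adj (\<lambda>v. \<eta> v + unit_mass x v) vs" "y \<in> set vs" "y \<notin> K" "x \<in> K"
    and stable: "\<And>v. v \<in> set vs \<Longrightarrow> \<eta> v < deg v"
  shows "escapes K x \<eta>"
proof -
  obtain us w ws where split: "vs = us @ w # ws" "w \<notin> K" "\<forall>v\<in>set us. v \<in> K"
    using split_list_first_prop[of vs "\<lambda>v. v \<notin> K"] assms(2,3) by blast
  let ?\<sigma> = "\<lambda>v. \<eta> v + unit_mass x v"
  have legal: "legal_sequence adj ?\<sigma> (us @ [w])" "legal_sequence adj ?\<sigma> us"
    "deg w \<le> fold (topple adj) us ?\<sigma> w"
    using assms(1) unfolding split(1) by (simp_all add: legal_sequence_append)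
  have "w \<in> closed_neighbourhood K"
  proof (rule ccontr)
    assume w: "w \<notin> closed_neighbourhood K"
    have "count_list us v = 0" if "adj w v" for v
    proof -
      have "v \<notin> K" using w that adj_sym unfolding closed_neighbourhood_def by blast
      then show ?thesis using split(3) by (auto simp: count_list_0_iff)
    qed
    moreover have "count_list us w = 0" using split by (auto simp: count_list_0_iff)
    ultimately have "int (fold (topple adj) us ?\<sigma> w) = int (?\<sigma> w)"
      using fold_topple_eq[OF legal(2), of w] by simp
    moreover have "unit_mass x w = 0" using split(2) \<open>x \<in> K\<close> by (auto simp: unit_mass_def)
    ultimately show False using legal(3) stable[of w] split(1) by simp
  qed
  then show ?thesis unfolding escapes_def using split legal by blast
qed

text \<open>The vertices of an escaping sequence are stable before the grain is added at \<open>x\<close>, so the first of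
  them to topple can only be \<open>x\<close>.\<close>

lemma diam_toppled_set_if_escapes:
  assumes "escapes {v. graph_dist adj x v \<le> enat r} x \<eta>"
    and stable: "\<And>v. v \<in> closed_neighbourhood {v. graph_dist adj x v \<le> enat r} \<Longrightarrow> \<eta> v < deg v"
  shows "enat r < graph_diam adj (toppled_set adj (\<lambda>v. \<eta> v + unit_mass x v))"
proof -
  let ?K = "{v. graph_dist adj x v \<le> enat r}"
  let ?\<sigma> = "\<lambda>v. \<eta> v + unit_mass x v"
  obtain us w where us: "set us \<subseteq> ?K" "w \<in> closed_neighbourhood ?K" "w \<notin> ?K"
    "legal_sequence adj ?\<sigma> (us @ [w])"
    using assms(1) unfolding escapes_def by blast
  obtain v vs where v: "us @ [w] = v # vs" by (cases "us @ [w]") auto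
  have "v \<in> closed_neighbourhood ?K"
    using v us(1,2) unfolding closed_neighbourhood_def by (cases us) auto
  then have "\<eta> v < deg v" by (rule stable)
  moreover have "deg v \<le> ?\<sigma> v" using us(4) unfolding v by simp
  ultimately have "v = x" by (auto simp: unit_mass_def split: if_splits)
  then have "x \<in> set (us @ [w])" using v by simp
  then have "x \<in> toppled_set adj ?\<sigma>" unfolding toppled_set_def using us(4) by blast
  moreover have "w \<in> toppled_set adj ?\<sigma>"
    unfolding toppled_set_def using us(4) by (auto intro!: exI[of _ "us @ [w]"])
  moreover have "enat r < graph_dist adj x w" using us(3) by simp
  ultimately show ?thesis unfolding less_graph_diam_iff by blast
qed

end

text \<open>The event is a countable union, over pairs of finite toppling sequences, of events that depend on
  finitely many heights.\<close>

lemma sets_diam_toppled_set: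
  fixes adj :: "'v \<Rightarrow> 'v \<Rightarrow> bool"
  assumes "countable (UNIV :: 'v set)"
    and "sets \<mu> = sets (Pi\<^sub>M UNIV (\<lambda>_::'v. count_space (UNIV :: nat set)))"
  shows "{\<eta>. r < graph_diam adj (toppled_set adj (\<lambda>v. \<eta> v + unit_mass x v))} \<in> sets \<mu>"
proof -
  let ?N = "Pi\<^sub>M UNIV (\<lambda>_::'v. count_space (UNIV :: nat set))"
  define L where "L vs = {\<eta> \<in> space ?N. legal_sequence adj (\<lambda>v. \<eta> v + unit_mass x v) vs}" for vs
  define I where "I = {(us, vs). \<exists>v\<in>set us. \<exists>w\<in>set vs. r < graph_dist adj v w}"
  have "L vs \<in> sets ?N" for vs unfolding L_def
  proof (rule sets_legal_sequence[where f = "\<lambda>\<eta> v. \<eta> v + unit_mass x v"])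
    fix u
    have "(\<lambda>\<eta>. \<eta> u) \<in> ?N \<rightarrow>\<^sub>M count_space UNIV" by (rule measurable_component_singleton) simp
    then show "(\<lambda>\<eta>. \<eta> u + unit_mass x u) \<in> ?N \<rightarrow>\<^sub>M count_space UNIV"
      by (rule measurable_compose[where g = "\<lambda>m. m + unit_mass x u"]) simp
  qed
  moreover have "countable I"
  proof -
    have "countable (UNIV :: 'v list set)" using countable_lists[OF assms(1)] by simp
    then have "countable ((UNIV :: 'v list set) \<times> (UNIV :: 'v list set))" by (intro countable_SIGMA)
    then show ?thesis by (rule countable_subset[rotated]) simp
  qed
  ultimately have "(\<Union>(us, vs)\<in>I. L us \<inter> L vs) \<in> sets ?N"
    by (intro sets.countable_UN') auto
  moreover have "{\<eta>. r < graph_diam adj (toppled_set adj (\<lambda>v. \<eta> v + unit_mass x v))} =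
      (\<Union>(us, vs)\<in>I. L us \<inter> L vs)"
    unfolding less_graph_diam_iff toppled_set_def L_def I_def by (auto simp: space_PiM)
  ultimately show ?thesis using assms(2) by simp
qed

section \<open>Passage to the infinite volume\<close>

lemma sandpile_domainI:
  assumes "infinite_connected_locally_finite_graph adj" "finite W"
  shows "sandpile_domain adj W"
  using assms unfolding infinite_connected_locally_finite_graph_def
  by unfold_locales (auto simp: irreflp_def dest: sympD)

lemma eventually_subset_exhaustion:
  assumes "exhaustion V" "finite A"
  shows "eventually (\<lambda>n. A \<subseteq> V n) sequentially"
proof -
  have "eventually (\<lambda>n. a \<in> V n) sequentially" for a
  proof -
    obtain m where "a \<in> V m" using assms(1) unfolding exhaustion_def by blast
    then show ?thesis using assms(1) unfolding exhaustion_def eventually_sequentially incseq_def by blast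
  qed
  then show ?thesis using assms(2) by (simp add: subset_iff eventually_ball_finite flip: Ball_def)
qed

lemma eventually_connected_within:
  assumes "infinite_connected_locally_finite_graph adj" "exhaustion V"
  shows "eventually (\<lambda>n. (\<lambda>a b. adj a b \<and> a \<in> V n \<and> b \<in> V n)\<^sup>*\<^sup>* x y) sequentially"
proof -
  have ev: "eventually (\<lambda>n. a \<in> V n) sequentially" for a
    using eventually_subset_exhaustion[OF assms(2), of "{a}"] by simp
  have "adj\<^sup>*\<^sup>* x y" using assms(1) unfolding infinite_connected_locally_finite_graph_def by blast
  then show ?thesis
  proof (induction rule: rtranclp_induct)
    case (step y z)
    show ?case using step.IH ev[of y] ev[of z]
      by eventually_elim (use step.hyps in \<open>auto intro: rtranclp.rtrancl_into_rtrancl\<close>)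
  qed simp
qed

theorem theorem1p2:
  fixes adj :: "'v \<Rightarrow> 'v \<Rightarrow> bool" and V :: "nat \<Rightarrow> 'v set" and \<mu> :: "('v \<Rightarrow> nat) measure"
  assumes "infinite_connected_locally_finite_graph adj"
    and "exhaustion V"
    and "infinite_volume_limit adj V \<mu>"
    and "\<exists>M::nat. \<forall>n. \<forall>\<eta>\<in>recurrent_sandpiles adj (V n).
           group.ord (sandpile_group adj (V n)) (sandpile_class adj (V n) \<eta>) < M"
  shows "\<exists>c>0. \<forall>x. \<forall>R::real. R > 0 \<longrightarrow>
           measure \<mu> {\<eta>. ereal_of_enat (graph_diam adj (toppled_set adj (\<lambda>v. \<eta> v + unit_mass x v))) > ereal R} > c"
proof -
  obtain M where M: "\<And>n \<eta>. \<eta> \<in> recurrent_sandpiles adj (V n) \<Longrightarrow>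
      group.ord (sandpile_group adj (V n)) (sandpile_class adj (V n) \<eta>) < M"
    using assms(4) by blast
  have finV: "finite (V n)" for n using assms(2) unfolding exhaustion_def by blast
  have dom: "sandpile_domain adj (V n)" for n using sandpile_domainI[OF assms(1) finV] .
  interpret locally_finite_graph adj using dom[of 0] unfolding sandpile_domain_def by blast
  interpret \<mu>: prob_space \<mu> using assms(3) unfolding infinite_volume_limit_def by blast
  have sets_\<mu>: "sets \<mu> = sets (Pi\<^sub>M UNIV (\<lambda>_::'v. count_space (UNIV :: nat set)))"
    and lim: "\<And>A \<xi>. finite A \<Longrightarrow>
      (\<lambda>n. measure_pmf.prob (pmf_of_set (recurrent_sandpiles adj (V n))) {\<eta>. \<forall>v\<in>A. \<eta> v = \<xi> v})
        \<longlonglongrightarrow> measure \<mu> {\<eta>. \<forall>v\<in>A. \<eta> v = \<xi> v}"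
    using assms(3) unfolding infinite_volume_limit_def by blast+
  have countable: "countable (UNIV :: 'v set)"
  proof -
    have "countable (\<Union>n. V n)" using finV by (intro countable_UN) (auto intro: countable_finite)
    then show ?thesis using assms(2) unfolding exhaustion_def by simp
  qed
  have infinite: "infinite (UNIV :: 'v set)"
    using assms(1) unfolding infinite_connected_locally_finite_graph_def by blast
  have bound: "1 / fact M \<le> measure \<mu> {\<eta>. enat r < graph_diam adj (toppled_set adj (\<lambda>v. \<eta> v + unit_mass x v))}"
    for x r
  proof -
    let ?E = "{\<eta>. enat r < graph_diam adj (toppled_set adj (\<lambda>v. \<eta> v + unit_mass x v))}"
    let ?P = "\<lambda>n. measure_pmf.prob (pmf_of_set (recurrent_sandpiles adj (V n)))"
    define K where "K = {v. graph_dist adj x v \<le> enat r}"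
    define B where "B = closed_neighbourhood K"
    have "finite K" unfolding K_def by (rule finite_ball)
    then have "finite B" unfolding B_def closed_neighbourhood_def using finite_nbrs by blast
    have "x \<in> K" by (simp add: K_def graph_dist_self)
    obtain y where y: "y \<notin> K" using ex_new_if_finite[OF infinite \<open>finite K\<close>] by blast
    define cyl where "cyl \<xi> = {\<eta>. \<forall>v\<in>B. \<eta> v = \<xi> v}" for \<xi> :: "'v \<Rightarrow> nat"
    define S where "S = {\<xi> \<in> (\<Pi>\<^sub>E v\<in>B. {..<deg v}). escapes K x \<xi>}"
    have "finite S"
      unfolding S_def using \<open>finite B\<close> by (intro finite_subset[OF _ finite_PiE[of B "\<lambda>v. {..<deg v}"]]) auto
    have disj: "disjoint_family_on cyl S"
      unfolding disjoint_family_on_def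
    proof (intro ballI impI)
      fix \<xi> \<xi>' assume "\<xi> \<in> S" "\<xi>' \<in> S" "\<xi> \<noteq> \<xi>'"
      then obtain v where "v \<in> B" "\<xi> v \<noteq> \<xi>' v"
        unfolding S_def by (metis (mono_tags, lifting) PiE_ext mem_Collect_eq)
      then show "cyl \<xi> \<inter> cyl \<xi>' = {}" unfolding cyl_def by force
    qed
    \<comment> \<open>The event that the avalanche leaves \<open>K\<close>, restricted to stable heights on \<open>B\<close>, is the finite
      disjoint union of the cylinders over \<open>S\<close>.\<close>
    have "eventually (\<lambda>n. 1 / fact M \<le> (\<Sum>\<xi>\<in>S. ?P n (cyl \<xi>))) sequentially"
      using eventually_connected_within[OF assms(1,2), of x y]
        eventually_subset_exhaustion[OF assms(2) \<open>finite B\<close>]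
    proof eventually_elim
      case (elim n)
      interpret sandpile_domain adj "V n" by (rule dom)
      have "x \<in> V n" using elim(2) \<open>x \<in> K\<close> by (auto simp: B_def closed_neighbourhood_def)
      then have ne: "V n \<noteq> {}" by blast
      let ?R = "recurrent_sandpiles adj (V n)"
      have R: "set_pmf (pmf_of_set ?R) = ?R"
        using recurrent_nonempty[OF ne] finite_recurrent by simp
      have "{\<eta>. topples_within x y \<eta>} \<inter> ?R \<subseteq> (\<Union>\<xi>\<in>S. cyl \<xi>)"
      proof
        fix \<eta> assume \<eta>: "\<eta> \<in> {\<eta>. topples_within x y \<eta>} \<inter> ?R"
        then obtain vs where vs: "set vs \<subseteq> V n" "legal_sequence adj (\<lambda>v. \<eta> v + unit_mass x v) vs" "y \<in> set vs"
          unfolding topples_within_def by blast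
        have stable: "\<eta> v < deg v" if "v \<in> V n" for v
          using \<eta> recurrent_stable that stable_iff by blast
        have "escapes K x \<eta>"
          using vs stable y \<open>x \<in> K\<close> by (intro escapes_if_topples_outside[OF vs(2,3)]) auto
        then have "escapes K x (restrict \<eta> B)"
          using escapes_cong[of K \<eta> "restrict \<eta> B" x] unfolding B_def by simp
        then have "restrict \<eta> B \<in> S" unfolding S_def using stable elim(2) by auto
        then show "\<eta> \<in> (\<Union>\<xi>\<in>S. cyl \<xi>)" by (rule UN_I) (simp add: cyl_def)
      qed
      then have "?P n ({\<eta>. topples_within x y \<eta>} \<inter> ?R) \<le> ?P n (\<Union>\<xi>\<in>S. cyl \<xi>)"
        by (intro measure_pmf.finite_measure_mono) auto
      moreover have "?P n ({\<eta>. topples_within x y \<eta>} \<inter> ?R) = ?P n {\<eta>. topples_within x y \<eta>}"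
        using measure_Int_set_pmf[of "pmf_of_set ?R"] unfolding R .
      moreover have "?P n (\<Union>\<xi>\<in>S. cyl \<xi>) = (\<Sum>\<xi>\<in>S. ?P n (cyl \<xi>))"
        using \<open>finite S\<close> disj by (intro measure_pmf.finite_measure_finite_Union) auto
      ultimately show ?case
        using prob_topples_within[OF ne M \<open>x \<in> V n\<close> elim(1)] by simp
    qed
    moreover have "(\<lambda>n. \<Sum>\<xi>\<in>S. ?P n (cyl \<xi>)) \<longlonglongrightarrow> (\<Sum>\<xi>\<in>S. measure \<mu> (cyl \<xi>))"
      unfolding cyl_def using lim[OF \<open>finite B\<close>] by (intro tendsto_sum)
    ultimately have "1 / fact M \<le> (\<Sum>\<xi>\<in>S. measure \<mu> (cyl \<xi>))"
      by (intro tendsto_lowerbound[where F = sequentially]) auto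
    also have "\<dots> = measure \<mu> (\<Union>\<xi>\<in>S. cyl \<xi>)"
    proof (rule \<mu>.finite_measure_finite_Union[symmetric, OF \<open>finite S\<close> _ disj])
      have "cyl \<xi> \<in> sets \<mu>" for \<xi>
      proof -
        have "{\<eta> \<in> space (Pi\<^sub>M UNIV (\<lambda>_::'v. count_space (UNIV :: nat set))). \<forall>v\<in>B. \<eta> v = \<xi> v} \<in>
            sets (Pi\<^sub>M UNIV (\<lambda>_::'v. count_space (UNIV :: nat set)))"
          using \<open>finite B\<close> by measurable
        then show ?thesis unfolding sets_\<mu> cyl_def by (simp add: space_PiM)
      qed
      then show "cyl ` S \<subseteq> sets \<mu>" by blast
    qed
    also have "\<dots> \<le> measure \<mu> ?E"
    proof (rule \<mu>.finite_measure_mono)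
      show "(\<Union>\<xi>\<in>S. cyl \<xi>) \<subseteq> ?E"
      proof
        fix \<eta> assume "\<eta> \<in> (\<Union>\<xi>\<in>S. cyl \<xi>)"
        then obtain \<xi> where \<xi>: "\<xi> \<in> S" "\<And>v. v \<in> B \<Longrightarrow> \<eta> v = \<xi> v" unfolding cyl_def by blast
        have "escapes K x \<eta>" using \<xi> escapes_cong[of K \<eta> \<xi> x] unfolding S_def B_def by blast
        moreover have "\<eta> v < deg v" if "v \<in> B" for v
          using \<xi>(1) \<xi>(2)[OF that] that unfolding S_def by auto
        ultimately show "\<eta> \<in> ?E"
          using diam_toppled_set_if_escapes[of x r \<eta>] unfolding K_def B_def by blast
      qed
      show "?E \<in> sets \<mu>" by (rule sets_diam_toppled_set[OF countable sets_\<mu>])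
    qed
    finally show ?thesis .
  qed
  show ?thesis
  proof (intro exI[of _ "1 / (2 * fact M)"] conjI allI impI)
    fix x :: 'v and R :: real
    assume "R > 0"
    have "1 / (2 * fact M) < (1 :: real) / fact M" by (simp add: field_simps)
    also have "\<dots> \<le> measure \<mu> {\<eta>. ereal R <
        ereal_of_enat (graph_diam adj (toppled_set adj (\<lambda>v. \<eta> v + unit_mass x v)))}"
      using bound[of "nat \<lfloor>R\<rfloor>" x] ereal_less_ereal_of_enat_iff[of R] \<open>R > 0\<close> by simp
    finally show "1 / (2 * fact M) < measure \<mu> {\<eta>. ereal R <
        ereal_of_enat (graph_diam adj (toppled_set adj (\<lambda>v. \<eta> v + unit_mass x v)))}" .
  qed simp
qed

end
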